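(* Let $f:\mathbb{R}^n\to\mathbb{R}^n$ be a (polynomial) vector field, asymptotically quasi-homogeneous at infinity of type $\alpha$ and order $k+1$. Let $T_{para}:\mathbb{R}^n\to\mathcal{D}$ be the quasi-parabolic compactification of type $\alpha$ and $\frac{dx}{d\tau}=g(x)$ on $\overline{\mathcal{D}}$ the associated desingularized vector field. Let $y_0\in\mathbb{R}^n$ and $x_0=T_{para}(y_0)$. Assume the following data have been validated: 1. a point $x_*\in\mathcal{E}=\partial\mathcal{D}$ with $g(x_* )=0$; 2. a compact set $\tilde N\subset\overline{\mathcal{D}}$, star-shaped with respect to $x_*\in\tilde N$, and a positive definite real symmetric matrix $Y$ such that $A(x)=Dg(x)^TY+YDg(x)$ is strictly negative definite for all $x\in\tilde N$; 3. with $L(x)=(x-x_* )^TY(x-x_* )$, the maximal $\epsilon>0$ such that $N:=\{x\in\overline{\mathcal{D}}\mid L(x)\le\epsilon\}\subset\tilde N$, and a time $\tau_N>0$ such that the solution $x(\tau)$ of $\frac{dx}{d\tau}=g(x)$, $x(0)=x_0$, exists on $[0,\tau_N]$ and satisfies $x(\tau_N)\in\mathrm{int}\,N=\{x\in\overline{\mathcal D}\mid L(x)<\epsilon\}$; 4. the quantity $\overline{C_{n,\alpha,k,N}}(\epsilon)=\dfrac{1}{c_{\tilde N}c_1}\displaystyle\int_0^\epsilon\frac{C_{n,\alpha,N}(L)^k}{L}\,dL$ is finite. Then $x_*$ is an asymptotically stable equilibrium of $g$ on $\overline{\mathcal D}$, $x(\tau)$ exists for all $\tau\in[0,\infty)$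 with $x(\tau)\to x_*$ as $\tau\to\infty$, and the corresponding solution $y(t)=T_{para}^{-1}(x)$ of $y'=f(y)$, $y(0)=y_0$, is a blow-up solution whose blow-up time satisfies $$t_{\max}\in[t_N,\ t_N+\overline{C_{n,\alpha,k,N}}(\epsilon)],\qquad t_N=\int_0^{\tau_N}\left(1-\frac{2c-1}{2c}(1-p(x(\tau))^{2c})\right)(1-p(x(\tau))^{2c})^k\,d\tau .$$
   Context: Natural numbers are $\ge1$; $\alpha=(\alpha_1,\dots,\alpha_n)$ and $k$ consist of natural numbers, and $\beta_1,\dots,\beta_n,c$ are natural numbers with $\alpha_1\beta_1=\cdots=\alpha_n\beta_n=c$. Quasi-homogeneity: $h:\mathbb{R}^n\to\mathbb{R}$ is homogeneous of type $\alpha$ and order $m$ if $h(r^{\alpha_1}x_1,\dots,r^{\alpha_n}x_n)=r^mh(x)$ for all $x\in\mathbb{R}^n$, $r\in\mathbb{R}$. A vector field $(h_1,\dots,h_n)$ is quasi-homogeneous of type $\alpha$ and order $k+1$ if each $h_j$ is homogeneous of type $\alpha$ and order $k+\alpha_j$. A vector field $f$ is asymptotically quasi-homogeneous at infinity of type $\alpha$ and order $k+1$ if there is a quasi-homogeneous vector field $f_{\alpha,k}$ of type $\alpha$ and order $k+1$ such that for each $j$, $\lim_{r\to+\infty}r^{-(k+\alpha_j)}\{f_j(r^{\alpha_1}x_1,\dots,r^{\alpha_n}x_n)-r^{k+\alpha_j}(f_{\alpha,k})_j(x)\}=0$ uniformly for $x\in S^{n-1}$. Quasi-parabolic compactification: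 $p(y)=\left(\sum_iy_i^{2\beta_i}\right)^{1/2c}$, $\mathcal{D}=\{p<1\}$, $\mathcal{E}=\partial\mathcal{D}=\{p=1\}$. $T_{para}:\mathbb{R}^n\to\mathcal{D}$ is the bijection whose inverse is $y_j=x_j/(1-p(x)^{2c})^{\alpha_j}$. Write $\kappa=(1-p(x)^{2c})^{-1}$. Time-variable desingularization: $d\tau=\kappa^{k}\left(1-\frac{2c-1}{2c}\kappa^{-1}\right)^{-1}dt$. The desingularized vector field $g$ is $$g_i(x)=\left(1-\frac{2c-1}{2c}(1-p(x)^{2c})\right)\tilde f_i(x)-\alpha_ix_i\sum_{j=1}^n\frac{x_j^{2\beta_j-1}}{\alpha_j}\tilde f_j(x),\quad \tilde f_j(x)=\kappa^{-(k+\alpha_j)}f_j(\kappa^{\alpha_1}x_1,\dots,\kappa^{\alpha_n}x_n),$$ where $\tilde f_j$ is extended continuously to $\mathcal{E}$; $g$ is $C^1$ on $\overline{\mathcal{D}}$. Constants: $c_1,c_{\tilde N}>0$ are constants such that $\frac{dL}{d\tau}\le-c_1c_{\tilde N}L$ along trajectories in $\tilde N$, i.e. $2(x-x_* )^TYg(x)\le-c_1c_{\tilde N}L(x)$ for $x\in\tilde N$. $C_{n,\alpha,N}$ is a nonnegative (measurable) function of the value of $L$ such that $|1-p(x)^{2c}|\le C_{n,\alpha,N}(L(x))$ for $x\in\tilde N$. A solution of $y'=f(y)$, $y(0)=y_0$ is a blow-up solution if its maximal (forward) existence time $t_{\max}$ is finite; $t_{\max}$ is then its blow-up time. *)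

theory Defs
  imports "HOL-Analysis.Analysis"
begin

section \<open>Vector fields, solutions, stability\<close>

text \<open>\<^term>\<open>jacobian F (at x within S)\<close> is the Jacobian matrix of \<^term>\<open>F\<close> relative to \<^term>\<open>S\<close>.
  The definition is meant for \<^term>\<open>S = UNIV\<close> or \<^term>\<open>S\<close> a convex set with nonempty
  interior, where the derivative within \<^term>\<open>S\<close> is unique also at boundary points.\<close>

definition C1_on :: "(real^'n) set \<Rightarrow> (real^'n \<Rightarrow> real^'n) \<Rightarrow> bool" where
  "C1_on S F \<longleftrightarrow> F differentiable_on S \<and> continuous_on S (\<lambda>x. jacobian F (at x within S))"

definition ode_solution ::
  "(real^'n \<Rightarrow> real^'n) \<Rightarrow> (real^'n) set \<Rightarrow> real^'n \<Rightarrow> real set \<Rightarrow> (real \<Rightarrow> real^'n) \<Rightarrow> bool" where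
  "ode_solution F S x0 I x \<longleftrightarrow>
     x 0 = x0 \<and> (\<forall>t\<in>I. x t \<in> S \<and> (x has_vector_derivative F (x t)) (at t within I))"

text \<open>A blow-up solution with blow-up time \<^term>\<open>T\<close>: its maximal forward interval of existence is
  \<^term>\<open>{0..<T}\<close> with \<^term>\<open>T\<close> a (finite) real number.\<close>

definition blow_up_solution ::
  "(real^'n \<Rightarrow> real^'n) \<Rightarrow> real^'n \<Rightarrow> (real \<Rightarrow> real^'n) \<Rightarrow> real \<Rightarrow> bool" where
  "blow_up_solution F y0 y T \<longleftrightarrow>
     T > 0 \<and> ode_solution F UNIV y0 {0..<T} y \<and>
     \<not> (\<exists>T'>T. \<exists>z. ode_solution F UNIV y0 {0..<T'} z \<and> (\<forall>t\<in>{0..<T}. z t = y t))"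

definition asymptotically_stable ::
  "(real^'n \<Rightarrow> real^'n) \<Rightarrow> (real^'n) set \<Rightarrow> real^'n \<Rightarrow> bool" where
  "asymptotically_stable F S z \<longleftrightarrow> z \<in> S \<and> F z = 0 \<and>
     (\<forall>e>0. \<exists>d>0. \<forall>x0\<in>S. dist x0 z < d \<longrightarrow>
        (\<exists>x. ode_solution F S x0 {0..} x) \<and>
        (\<forall>x. ode_solution F S x0 {0..} x \<longrightarrow> (\<forall>t\<ge>0. dist (x t) z < e))) \<and>
     (\<exists>d>0. \<forall>x0\<in>S. dist x0 z < d \<longrightarrow>
        (\<forall>x. ode_solution F S x0 {0..} x \<longrightarrow> (x \<longlongrightarrow> z) at_top))"

definition pos_def :: "real^'n^'n \<Rightarrow> bool" where
  "pos_def A \<longleftrightarrow> (\<forall>v. v \<noteq> 0 \<longrightarrow> 0 < v \<bullet> (A *v v))"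

definition neg_def :: "real^'n^'n \<Rightarrow> bool" where
  "neg_def A \<longleftrightarrow> (\<forall>v. v \<noteq> 0 \<longrightarrow> v \<bullet> (A *v v) < 0)"


section \<open>Quasi-homogeneity\<close>

definition dil :: "('n \<Rightarrow> nat) \<Rightarrow> real \<Rightarrow> real^'n \<Rightarrow> real^'n" where
  "dil \<alpha> r x = (\<chi> i. r ^ \<alpha> i * x $ i)"

definition homogeneous :: "('n \<Rightarrow> nat) \<Rightarrow> nat \<Rightarrow> (real^'n \<Rightarrow> real) \<Rightarrow> bool" where
  "homogeneous \<alpha> m h \<longleftrightarrow> (\<forall>x r. h (dil \<alpha> r x) = r ^ m * h x)"

text \<open>In the next two definitions \<^term>\<open>k\<close> is such that the order of the field is \<^term>\<open>k + 1\<close>.\<close>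

definition quasi_homogeneous :: "('n \<Rightarrow> nat) \<Rightarrow> nat \<Rightarrow> (real^'n \<Rightarrow> real^'n) \<Rightarrow> bool" where
  "quasi_homogeneous \<alpha> k h \<longleftrightarrow> (\<forall>j. homogeneous \<alpha> (k + \<alpha> j) (\<lambda>x. h x $ j))"

definition asymp_quasi_homogeneous :: "('n \<Rightarrow> nat) \<Rightarrow> nat \<Rightarrow> (real^'n \<Rightarrow> real^'n) \<Rightarrow> bool" where
  "asymp_quasi_homogeneous \<alpha> k f \<longleftrightarrow> (\<exists>fak. quasi_homogeneous \<alpha> k fak \<and>
     (\<forall>j. uniform_limit (sphere 0 1)
        (\<lambda>r x. (f (dil \<alpha> r x) $ j - r ^ (k + \<alpha> j) * fak x $ j) / r ^ (k + \<alpha> j))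
        (\<lambda>_. 0) at_top))"


section \<open>Quasi-parabolic compactification\<close>

definition pfun :: "('n::finite \<Rightarrow> nat) \<Rightarrow> nat \<Rightarrow> real^'n \<Rightarrow> real" where
  "pfun \<beta> c y = root (2 * c) (\<Sum>i\<in>UNIV. (y $ i) ^ (2 * \<beta> i))"

definition Dset :: "('n::finite \<Rightarrow> nat) \<Rightarrow> nat \<Rightarrow> (real^'n) set" where
  "Dset \<beta> c = {x. pfun \<beta> c x < 1}"

definition Eset :: "('n::finite \<Rightarrow> nat) \<Rightarrow> nat \<Rightarrow> (real^'n) set" where
  "Eset \<beta> c = frontier (Dset \<beta> c)"

definition T_para_inv :: "('n::finite \<Rightarrow> nat) \<Rightarrow> ('n \<Rightarrow> nat) \<Rightarrow> nat \<Rightarrow> real^'n \<Rightarrow> real^'n" where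
  "T_para_inv \<alpha> \<beta> c x = (\<chi> j. x $ j / (1 - pfun \<beta> c x ^ (2 * c)) ^ \<alpha> j)"

definition T_para :: "('n::finite \<Rightarrow> nat) \<Rightarrow> ('n \<Rightarrow> nat) \<Rightarrow> nat \<Rightarrow> real^'n \<Rightarrow> real^'n" where
  "T_para \<alpha> \<beta> c = the_inv_into (Dset \<beta> c) (T_para_inv \<alpha> \<beta> c)"

definition kappa :: "('n::finite \<Rightarrow> nat) \<Rightarrow> nat \<Rightarrow> real^'n \<Rightarrow> real" where
  "kappa \<beta> c x = inverse (1 - pfun \<beta> c x ^ (2 * c))"

definition f_tilde_int ::
  "('n::finite \<Rightarrow> nat) \<Rightarrow> ('n \<Rightarrow> nat) \<Rightarrow> nat \<Rightarrow> nat \<Rightarrow> (real^'n \<Rightarrow> real^'n) \<Rightarrow> real^'n \<Rightarrow> real^'n" where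
  "f_tilde_int \<alpha> \<beta> c k f x =
     (\<chi> j. f (dil \<alpha> (kappa \<beta> c x) x) $ j / kappa \<beta> c x ^ (k + \<alpha> j))"

text \<open>Off the open domain, i.e.\ on its boundary, the value is the one of the continuous extension.\<close>

definition f_tilde ::
  "('n::finite \<Rightarrow> nat) \<Rightarrow> ('n \<Rightarrow> nat) \<Rightarrow> nat \<Rightarrow> nat \<Rightarrow> (real^'n \<Rightarrow> real^'n) \<Rightarrow> real^'n \<Rightarrow> real^'n" where
  "f_tilde \<alpha> \<beta> c k f x =
     (if x \<in> Dset \<beta> c then f_tilde_int \<alpha> \<beta> c k f x
      else Lim (at x within Dset \<beta> c) (f_tilde_int \<alpha> \<beta> c k f))"

definition time_factor :: "('n::finite \<Rightarrow> nat) \<Rightarrow> nat \<Rightarrow> real^'n \<Rightarrow> real" where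
  "time_factor \<beta> c x = 1 - (2 * real c - 1) / (2 * real c) * (1 - pfun \<beta> c x ^ (2 * c))"

definition desing_field ::
  "('n::finite \<Rightarrow> nat) \<Rightarrow> ('n \<Rightarrow> nat) \<Rightarrow> nat \<Rightarrow> nat \<Rightarrow> (real^'n \<Rightarrow> real^'n) \<Rightarrow> real^'n \<Rightarrow> real^'n" where
  "desing_field \<alpha> \<beta> c k f x =
     (\<chi> i. time_factor \<beta> c x * f_tilde \<alpha> \<beta> c k f x $ i
        - real (\<alpha> i) * x $ i *
          (\<Sum>j\<in>UNIV. (x $ j) ^ (2 * \<beta> j - 1) / real (\<alpha> j) * f_tilde \<alpha> \<beta> c k f x $ j))"

text \<open>The original time \<open>t\<close> as a function of \<open>\<tau>\<close> along a trajectory \<^term>\<open>x\<close>, obtained by integrating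
  the reciprocal of \<open>d\<tau>/dt = \<kappa>^k (1 - (2c - 1)/(2c) \<kappa>^(-1))^(-1)\<close>.\<close>

definition orig_time ::
  "('n::finite \<Rightarrow> nat) \<Rightarrow> nat \<Rightarrow> nat \<Rightarrow> (real \<Rightarrow> real^'n) \<Rightarrow> real \<Rightarrow> real" where
  "orig_time \<beta> c k x \<tau> =
     integral {0..\<tau>} (\<lambda>s. time_factor \<beta> c (x s) * (1 - pfun \<beta> c (x s) ^ (2 * c)) ^ k)"


section \<open>Lyapunov function\<close>

definition lyap :: "real^'n^'n \<Rightarrow> real^'n \<Rightarrow> real^'n \<Rightarrow> real" where
  "lyap Y z x = (x - z) \<bullet> (Y *v (x - z))"

definition sublevel :: "(real^'n) set \<Rightarrow> real^'n^'n \<Rightarrow> real^'n \<Rightarrow> real \<Rightarrow> (real^'n) set" where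
  "sublevel S Y z \<epsilon> = {x \<in> S. lyap Y z x \<le> \<epsilon>}"

end

theory Submission
  imports Defs
begin

text \<open>Write \<open>P = p^(2c)\<close>. For every \<open>x\<close> one has \<open>grad P \<bullet> g = (1 - P) S\<close> with
  \<open>S = (\<Sum>j. x\<^sub>j^(2 \<beta>\<^sub>j - 1) F\<^sub>j / \<alpha>\<^sub>j)\<close>,
  where \<open>F\<close> is the rescaled field, so \<open>g\<close> is tangent to \<open>P = 1\<close>; since \<open>g\<close> is Lipschitz this gives
  \<open>\<bar>d(1 - P)/d\<tau>\<bar> \<le> K \<bar>1 - P\<bar>\<close>, and trajectories can neither leave the closed domain nor reach its
  boundary from inside in finite time. Global solutions therefore exist, and inside \<open>N\<close> the Lyapunov
  inequality forces exponential decay of \<open>L\<close>, hence convergence to \<open>x\<^sub>*\<close>. In the original time the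
  remaining duration after \<open>\<tau>\<^sub>N\<close> is at most \<open>\<integral> (1 - P)^k d\<tau> \<le> \<integral> C(L)^k d\<tau>\<close>, which the
  substitution \<open>l = L\<close> bounds by \<open>1/(c\<^sub>1 c\<^sub>N) \<integral> C(l)^k / l dl\<close>. At the resulting finite time the
  solution blows up, because \<open>\<kappa> \<rightarrow> \<infinity>\<close> while \<open>x \<rightarrow> x\<^sub>* \<noteq> 0\<close>.\<close>

section \<open>Ordinary differential equations with a Lipschitz field\<close>

lemma integral_has_vector_derivative_atLeast:
  fixes h :: "real \<Rightarrow> 'a::banach"
  assumes "continuous_on {0..} h" "t \<ge> 0"
  shows "((\<lambda>u. integral {0..u} h) has_vector_derivative h t) (at t within {0..})"
proof -
  have "((\<lambda>u. integral {0..u} h) has_vector_derivative h t) (at t within {0..t+1})"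
    using assms by (intro integral_has_vector_derivative continuous_on_subset[OF assms(1)]) auto
  moreover have "at t within {0..t+1} = at t within {0..}"
    by (rule at_within_nhd[of _ "{..<t+1}"]) auto
  ultimately show ?thesis by simp
qed

text \<open>Differential Gronwall inequality: multiplying by \<open>exp (- K * t)\<close> makes
  \<open>u\<close> nonincreasing. Below it is also used with negative \<open>K\<close> to get decay,
  and with negated functions to get lower bounds.\<close>

lemma exp_growth_bound:
  fixes u u' :: "real \<Rightarrow> real"
  assumes "a \<le> b"
    and der: "\<And>t. t \<in> {a..b} \<Longrightarrow> (u has_real_derivative u' t) (at t within {a..b})"
    and le: "\<And>t. t \<in> {a..b} \<Longrightarrow> u' t \<le> K * u t"
  shows "u b \<le> u a * exp (K * (b - a))"
proof -
  define v where "v t = u t * exp (- K * t)" for t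
  have dv: "(v has_real_derivative (u' t - K * u t) * exp (- K * t)) (at t within {a..b})"
    if "t \<in> {a..b}" for t
    unfolding v_def
    by (rule derivative_eq_intros der[OF that] refl)+ (simp add: algebra_simps)
  have "v b \<le> v a"
  proof (rule DERIV_nonpos_imp_decreasing_open[OF \<open>a \<le> b\<close>])
    fix t assume t: "a < t" "t < b"
    then have "at t within {a..b} = at t"
      by (intro at_within_Icc_at)
    then show "\<exists>y. DERIV v t :> y \<and> y \<le> 0"
      using dv[of t] le[of t] t by (auto intro!: exI[of _ "(u' t - K * u t) * exp (- K * t)"] mult_nonpos_nonneg)
  next
    show "continuous_on {a..b} v"
      by (rule DERIV_continuous_on) (rule dv)
  qed
  then have "v b * exp (K * b) \<le> v a * exp (K * b)"
    by simp
  then show ?thesis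
    by (simp add: v_def algebra_simps flip: exp_add)
qed

text \<open>Gronwall applied to the square of \<open>u\<close> and to its negative bounds that
  square from both sides by exponentials. So \<open>u\<close> vanishes everywhere or nowhere, and in
  the second case the intermediate value theorem forbids a sign change.\<close>

lemma linear_rate_preserves_sign:
  fixes u u' :: "real \<Rightarrow> real"
  assumes "a \<le> b"
    and der: "\<And>t. t \<in> {a..b} \<Longrightarrow> (u has_real_derivative u' t) (at t within {a..b})"
    and le: "\<And>t. t \<in> {a..b} \<Longrightarrow> \<bar>u' t\<bar> \<le> K * \<bar>u t\<bar>"
  shows "sgn (u b) = sgn (u a)"
proof -
  have uu: "\<bar>u t * u' t\<bar> \<le> K * (u t)\<^sup>2" if "t \<in> {a..b}" for t
    using mult_left_mono[OF le[OF that], of "\<bar>u t\<bar>"]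
    by (simp add: abs_mult power2_eq_square mult_ac)
  have up: "(u t)\<^sup>2 \<le> (u a)\<^sup>2 * exp (2 * K * (t - a))" if t: "t \<in> {a..b}" for t
  proof (rule exp_growth_bound)
    fix s assume s: "s \<in> {a..t}"
    with t have s': "s \<in> {a..b}" by auto
    show "((\<lambda>s. (u s)\<^sup>2) has_real_derivative 2 * (u s * u' s)) (at s within {a..t})"
      by (rule derivative_eq_intros DERIV_subset[OF der[OF s']] refl)+ (use t in auto)
    show "2 * (u s * u' s) \<le> 2 * K * (u s)\<^sup>2"
      using uu[OF s'] by auto
  qed (use t in auto)
  have low: "- (u t)\<^sup>2 \<le> - (u a)\<^sup>2 * exp (- 2 * K * (t - a))" if t: "t \<in> {a..b}" for t
  proof (rule exp_growth_bound)
    fix s assume s: "s \<in> {a..t}"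
    with t have s': "s \<in> {a..b}" by auto
    show "((\<lambda>s. - (u s)\<^sup>2) has_real_derivative - 2 * (u s * u' s)) (at s within {a..t})"
      by (rule derivative_eq_intros DERIV_subset[OF der[OF s']] refl)+ (use t in auto)
    show "- 2 * (u s * u' s) \<le> - 2 * K * - (u s)\<^sup>2"
      using uu[OF s'] by auto
  qed (use t in auto)
  \<comment> \<open>The upper bound makes a zero at \<open>a\<close> persist; the lower bound keeps
    a nonzero value away from zero.\<close>
  have zero: "u t = 0 \<longleftrightarrow> u a = 0" if "t \<in> {a..b}" for t
    using up[OF that] low[OF that] by (auto simp: mult_le_0_iff)
  have cont: "continuous_on {a..b} u"
    by (rule DERIV_continuous_on) (rule der)
  show ?thesis
  proof (cases "u a" "0::real" rule: linorder_cases)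
    case less
    have "\<not> u b \<ge> 0"
    proof
      assume "u b \<ge> 0"
      then obtain t where "t \<in> {a..b}" "u t = 0"
        using IVT'[of u a 0 b] less \<open>a \<le> b\<close> cont by auto
      then show False using zero[of t] less by simp
    qed
    then show ?thesis using less by (simp add: sgn_if)
  next
    case equal
    then show ?thesis using zero[of b] \<open>a \<le> b\<close> by auto
  next
    case greater
    have "\<not> u b \<le> 0"
    proof
      assume "u b \<le> 0"
      then obtain t where "t \<in> {a..b}" "u t = 0"
        using IVT2'[of u b 0 a] greater \<open>a \<le> b\<close> cont by auto
      then show False using zero[of t] greater by simp
    qed
    then show ?thesis using greater by (simp add: sgn_if)
  qed
qed

text \<open>Gronwall for the squared distance, which starts at 0. The Lipschitz bound is asked on
  \<open>S\<close> only, because \<open>g\<close> is controlled only on the closed domain.\<close>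

lemma ode_unique:
  fixes F :: "'a::euclidean_space \<Rightarrow> 'a"
  assumes lip: "L-lipschitz_on S F" and "0 \<le> T"
    and x: "\<And>t. t \<in> {0..T} \<Longrightarrow> x t \<in> S \<and> (x has_vector_derivative F (x t)) (at t within {0..T})"
    and z: "\<And>t. t \<in> {0..T} \<Longrightarrow> z t \<in> S \<and> (z has_vector_derivative F (z t)) (at t within {0..T})"
    and "x 0 = z 0"
  shows "x T = z T"
proof -
  define u where "u t = (x t - z t) \<bullet> (x t - z t)" for t
  have "u T \<le> u 0 * exp (2 * L * (T - 0))"
  proof (rule exp_growth_bound[OF \<open>0 \<le> T\<close>])
    fix t assume t: "t \<in> {0..T}"
    have "((\<lambda>t. x t - z t) has_vector_derivative F (x t) - F (z t)) (at t within {0..T})"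
      using x[OF t] z[OF t] by (auto intro!: derivative_eq_intros)
    then show "(u has_real_derivative 2 * ((x t - z t) \<bullet> (F (x t) - F (z t)))) (at t within {0..T})"
      unfolding u_def has_real_derivative_iff_has_vector_derivative
      by (auto intro!: bounded_bilinear.has_vector_derivative[OF bounded_bilinear_inner, THEN has_vector_derivative_eq_rhs]
          simp: inner_commute)
    have "(x t - z t) \<bullet> (F (x t) - F (z t)) \<le> norm (x t - z t) * norm (F (x t) - F (z t))"
      by (rule norm_cauchy_schwarz)
    also have "\<dots> \<le> norm (x t - z t) * (L * norm (x t - z t))"
      using lipschitz_onD[OF lip, of "x t" "z t"] x[OF t] z[OF t]
      by (intro mult_left_mono) (auto simp: dist_norm)
    also have "\<dots> = L * u t"
      by (simp add: u_def dot_square_norm power2_eq_square)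
    finally show "2 * ((x t - z t) \<bullet> (F (x t) - F (z t))) \<le> 2 * L * u t"
      by simp
  qed
  then have "u T \<le> 0" using \<open>x 0 = z 0\<close> by (simp add: u_def)
  then show ?thesis by (simp add: u_def dot_square_norm)
qed

text \<open>The Picard operator is contracting in the norm weighted by \<open>exp (-2 L t)\<close>; the substitution
  \<open>z t = exp (-2 L t) x t\<close> turns this into the sup norm.\<close>

lemma ode_global_existence:
  fixes F :: "'a::euclidean_space \<Rightarrow> 'a"
  assumes lip: "L-lipschitz_on UNIV F" and bdd: "bounded (range F)"
  obtains x where "x 0 = x0"
    "\<forall>t\<ge>0. (x has_vector_derivative F (x t)) (at t within {0..})"
proof -
  \<comment> \<open>The shift makes the constant positive even for \<open>L = 0\<close>, so that it
    can serve as a weight and a divisor.\<close>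
  define K where "K = L + 1"
  have K: "K > 0" "K-lipschitz_on UNIV F"
    using lipschitz_on_nonneg[OF lip] lipschitz_on_le[OF lip] by (auto simp: K_def)
  obtain M where M: "\<And>v. norm (F v) \<le> M" using bdd by (auto simp: bounded_iff)
  have "M \<ge> 0" using M[of 0] norm_ge_zero order_trans by blast
  have contF: "continuous_on A F" for A
    using lipschitz_on_continuous_on[OF lip] continuous_on_subset by blast
  define h where "h z r = F (exp (2 * K * r) *\<^sub>R apply_bcontfun z r)" for z :: "real \<Rightarrow>\<^sub>C 'a" and r
  define J where "J z s = integral {0..s} (h z)" for z s
  \<comment> \<open>The Picard operator in the weighted variable. \<open>max 0 t\<close> makes the
    result constant on negative times, since elements of \<open>bcontfun\<close> live on the whole
    line.\<close>
  define \<Phi> where "\<Phi> z t = exp (- 2 * K * max 0 t) *\<^sub>R (x0 + J z (max 0 t))" for z t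
  have conth: "continuous_on A (h z)" for A z
    unfolding h_def by (intro continuous_on_compose2[OF contF[of UNIV]] continuous_intros) auto
  have inth: "h z integrable_on {0..s}" for z s
    by (intro integrable_continuous_real conth)
  have derJ: "((\<lambda>s. J z s) has_vector_derivative h z t) (at t within {0..})" if "t \<ge> 0" for z t
    unfolding J_def using conth that by (rule integral_has_vector_derivative_atLeast)
  have contJ: "continuous_on {0..} (J z)" for z
    unfolding continuous_on_eq_continuous_within
    using derJ has_vector_derivative_continuous by (metis atLeast_iff)
  \<comment> \<open>As \<open>F\<close> is bounded, the integral \<open>J z\<close> grows at most
    linearly; this estimate lets the weight absorb that growth and keeps \<open>\<Phi> z\<close>
    bounded.\<close>
  have texp: "t * exp (- 2 * K * t) \<le> 1 / (2 * K)" for t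
  proof -
    have "2 * K * t \<le> exp (2 * K * t)" using exp_ge_add_one_self[of "2*K*t"] by linarith
    then have "2 * K * t * exp (- 2 * K * t) \<le> exp (2 * K * t) * exp (- 2 * K * t)"
      by (intro mult_right_mono) auto
    also have "\<dots> = 1" by (simp flip: exp_add)
    finally show ?thesis using K by (simp add: field_simps)
  qed
  have bcf: "\<Phi> z \<in> bcontfun" for z
  proof (rule bcontfun_normI)
    show "continuous_on UNIV (\<Phi> z)"
      unfolding \<Phi>_def by (intro continuous_intros continuous_on_compose2[OF contJ]) auto
    fix t :: real
    define s where "s = max 0 t"
    have "s \<ge> 0" by (simp add: s_def)
    have "norm (J z s) \<le> integral {0..s} (\<lambda>_. M)"
      unfolding J_def by (rule integral_norm_bound_integral[OF inth]) (auto simp: h_def M)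
    then have "norm (J z s) \<le> M * s" using \<open>s \<ge> 0\<close> by (simp add: mult.commute)
    then have "norm (x0 + J z s) \<le> norm x0 + M * s" using norm_triangle_ineq[of x0 "J z s"] by linarith
    then have "norm (\<Phi> z t) \<le> exp (- 2 * K * s) * (norm x0 + M * s)"
      unfolding \<Phi>_def s_def[symmetric] by (simp add: mult_left_mono)
    also have "\<dots> = exp (- 2 * K * s) * norm x0 + M * (s * exp (- 2 * K * s))"
      by (simp add: algebra_simps)
    also have "\<dots> \<le> 1 * norm x0 + M * (1 / (2 * K))"
      using texp[of s] \<open>M \<ge> 0\<close> K \<open>s \<ge> 0\<close> by (intro add_mono mult_mono) auto
    finally show "norm (\<Phi> z t) \<le> norm x0 + M / (2 * K)" by simp
  qed
  have "\<exists>!z. Bcontfun (\<Phi> z) = z"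
  proof (rule banach_fix_type[where c = "1/2"]; (intro allI)?)
    fix z w :: "real \<Rightarrow>\<^sub>C 'a"
    show "dist (Bcontfun (\<Phi> z)) (Bcontfun (\<Phi> w)) \<le> 1/2 * dist z w"
    proof (rule dist_bound)
      fix t :: real
      define s where "s = max 0 t"
      have "s \<ge> 0" by (simp add: s_def)
      have hd: "norm (h z r - h w r) \<le> K * dist z w * exp (2 * K * r)" for r
      proof -
        have "norm (h z r - h w r) \<le> K * dist (exp (2 * K * r) *\<^sub>R z r) (exp (2 * K * r) *\<^sub>R w r)"
          unfolding h_def dist_norm[symmetric] by (rule lipschitz_onD[OF K(2)]) auto
        also have "\<dots> = K * exp (2 * K * r) * dist (z r) (w r)" by (simp add: dist_norm flip: scaleR_diff_right)
        also have "\<dots> \<le> K * exp (2 * K * r) * dist z w"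
          using K by (intro mult_left_mono dist_bounded) auto
        finally show ?thesis by (simp add: mult_ac)
      qed
      \<comment> \<open>Integrating the weight gains a factor \<open>1 / (2 * K)\<close> against the
        Lipschitz factor \<open>K\<close>, hence the contraction constant
        \<open>1/2\<close>.\<close>
      have int: "((\<lambda>r. K * dist z w * exp (2 * K * r)) has_integral
          dist z w / 2 * exp (2 * K * s) - dist z w / 2 * exp (2 * K * 0)) {0..s}"
      proof (rule fundamental_theorem_of_calculus[OF \<open>s \<ge> 0\<close>])
        fix r
        show "((\<lambda>r. dist z w / 2 * exp (2 * K * r)) has_vector_derivative
            K * dist z w * exp (2 * K * r)) (at r within {0..s})"
          unfolding has_real_derivative_iff_has_vector_derivative[symmetric]
          by (rule derivative_eq_intros refl)+ simp
      qed
      have "norm (J z s - J w s) = norm (integral {0..s} (\<lambda>r. h z r - h w r))"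
        unfolding J_def by (simp add: integral_diff inth)
      also have "\<dots> \<le> integral {0..s} (\<lambda>r. K * dist z w * exp (2 * K * r))"
        using int by (intro integral_norm_bound_integral hd integrable_diff inth) (auto simp: has_integral_integrable)
      also have "\<dots> \<le> dist z w / 2 * exp (2 * K * s)"
        using integral_unique[OF int] by simp
      finally have J: "norm (J z s - J w s) \<le> dist z w / 2 * exp (2 * K * s)" .
      have "dist (Bcontfun (\<Phi> z) t) (Bcontfun (\<Phi> w) t) = exp (- 2 * K * s) * norm (J z s - J w s)"
        unfolding Bcontfun_inverse[OF bcf] by (simp add: \<Phi>_def s_def[symmetric] dist_norm flip: scaleR_diff_right)
      also have "\<dots> \<le> exp (- 2 * K * s) * (dist z w / 2 * exp (2 * K * s))"
        by (intro mult_left_mono J) auto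
      also have "\<dots> = 1/2 * dist z w" by (simp flip: exp_add)
      finally show "dist (Bcontfun (\<Phi> z) t) (Bcontfun (\<Phi> w) t) \<le> 1/2 * dist z w" .
    qed
  qed auto
  then obtain z where "Bcontfun (\<Phi> z) = z" by blast
  then have z: "apply_bcontfun z = \<Phi> z" using Bcontfun_inverse[OF bcf] by metis
  define x where "x t = x0 + J z t" for t
  have hx: "h z t = F (x t)" if "t \<ge> 0" for t
  proof -
    have "exp (2 * K * t) *\<^sub>R \<Phi> z t = x t"
      using that by (simp add: \<Phi>_def x_def flip: exp_add)
    then show ?thesis by (simp add: h_def z)
  qed
  show thesis
  proof (rule that)
    show "x 0 = x0" by (simp add: x_def J_def)
    show "\<forall>t\<ge>0. (x has_vector_derivative F (x t)) (at t within {0..})"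
      using has_vector_derivative_add[OF has_vector_derivative_const[of x0] derJ[of _ z]] hx
      by (simp add: x_def[abs_def])
  qed
qed

text \<open>With \<open>y\<close> the composition of \<open>w\<close> and the inverse of
  \<open>\<theta>\<close>, the chain rule cancels the speed \<open>\<rho>\<close> against the
  derivative \<open>1 / \<rho>\<close> of that inverse. This carries trajectories from the
  desingularized time to the original one.\<close>

lemma ode_time_change:
  fixes F :: "'a::real_normed_vector \<Rightarrow> 'a" and \<theta> \<rho> :: "real \<Rightarrow> real"
  assumes der: "\<And>\<tau>. \<tau> \<ge> 0 \<Longrightarrow> (\<theta> has_real_derivative \<rho> \<tau>) (at \<tau> within {0..})"
    and pos: "\<And>\<tau>. \<tau> \<ge> 0 \<Longrightarrow> \<rho> \<tau> > 0" and "\<theta> 0 = 0"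
    and w: "\<And>\<tau>. \<tau> \<ge> 0 \<Longrightarrow> (w has_vector_derivative \<rho> \<tau> *\<^sub>R F (w \<tau>)) (at \<tau> within {0..})"
  obtains y where "\<forall>\<tau>\<ge>0. y (\<theta> \<tau>) = w \<tau>"
    "\<forall>t\<in>\<theta> ` {0..}. (y has_vector_derivative F (y t)) (at t within \<theta> ` {0..})"
proof -
  \<comment> \<open>Extending \<open>\<theta>\<close> linearly to negative times makes the inverse function theorem applicable at 0.\<close>
  define \<theta>' where "\<theta>' \<tau> = (if \<tau> \<ge> 0 then \<theta> \<tau> else \<rho> 0 * \<tau>)" for \<tau>
  have d: "(\<theta>' has_real_derivative \<rho> (max 0 \<tau>)) (at \<tau>)" for \<tau>
  proof (cases \<tau> "0::real" rule: linorder_cases)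
    case less
    have "((\<lambda>\<tau>. \<rho> 0 * \<tau>) has_real_derivative \<rho> 0) (at \<tau>)"
      by (auto intro!: derivative_eq_intros)
    then show ?thesis
      using less has_field_derivative_transform_within_open[of "\<lambda>\<tau>. \<rho> 0 * \<tau>" "\<rho> 0" \<tau> "{..<0}" \<theta>']
      by (auto simp: \<theta>'_def)
  next
    case equal
    have "((\<lambda>\<tau>. \<rho> 0 * \<tau>) has_real_derivative \<rho> 0) (at 0 within {..0})"
      by (auto intro!: derivative_eq_intros)
    then have 1: "(\<theta>' has_real_derivative \<rho> 0) (at 0 within {..0})"
      by (rule has_field_derivative_transform_within[where d = 1]) (use \<open>\<theta> 0 = 0\<close> in \<open>auto simp: \<theta>'_def\<close>)
    have 2: "(\<theta>' has_real_derivative \<rho> 0) (at 0 within {0..})"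
      by (rule has_field_derivative_transform_within[OF der, where d = 1]) (auto simp: \<theta>'_def)
    have "(\<theta>' has_real_derivative \<rho> 0) (at 0 within {..0} \<union> {0..})"
      using 1 2 unfolding has_field_derivative_iff unfolding at_within_union by (rule filterlim_sup)
    moreover have "{..0::real} \<union> {0..} = UNIV" by auto
    ultimately show ?thesis using equal by simp
  next
    case greater
    have "at \<tau> within {0..} = at \<tau>"
      by (rule at_within_interior) (use greater in simp)
    then have "(\<theta> has_real_derivative \<rho> \<tau>) (at \<tau>)"
      using der[of \<tau>] greater by simp
    then show ?thesis
      using greater has_field_derivative_transform_within_open[of \<theta> "\<rho> \<tau>" \<tau> "{0<..}" \<theta>']
      by (auto simp: \<theta>'_def)
  qed
  have "strict_mono \<theta>'"
  proof (rule strict_monoI)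
    fix a b :: real assume "a < b"
    then show "\<theta>' a < \<theta>' b"
    proof (rule DERIV_pos_imp_increasing)
      fix \<tau>
      show "\<exists>y. (\<theta>' has_real_derivative y) (at \<tau>) \<and> 0 < y"
        using d[of \<tau>] pos[of "max 0 \<tau>"] by auto
    qed
  qed
  then have "inj \<theta>'" by (rule strict_mono_imp_inj_on)
  define \<sigma> where "\<sigma> = inv \<theta>'"
  have \<sigma>: "\<sigma> (\<theta>' \<tau>) = \<tau>" for \<tau> by (simp add: \<sigma>_def \<open>inj \<theta>'\<close>)
  have img: "\<theta> ` {0..} = \<theta>' ` {0..}" by (auto simp: \<theta>'_def)
  have \<sigma>img: "\<sigma> ` (\<theta> ` {0..}) = {0..}" by (simp add: img image_image \<sigma>)
  have cont: "continuous_on UNIV \<theta>'"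
    using d by (auto intro!: DERIV_continuous_on simp: has_field_derivative_at_within)
  have d\<sigma>: "(\<sigma> has_real_derivative inverse (\<rho> \<tau>)) (at (\<theta> \<tau>))" if "\<tau> \<ge> 0" for \<tau>
  proof -
    have "(\<sigma> has_derivative (*) (inverse (\<rho> \<tau>))) (at (\<theta>' \<tau>))"
      using d[of \<tau>] pos[OF that] that
      by (intro has_derivative_inverse_strong[of UNIV \<tau> \<theta>' \<sigma> "(*) (\<rho> \<tau>)"] cont \<sigma>)
        (auto simp: has_field_derivative_def max_def fun_eq_iff)
    then show ?thesis using that by (simp add: has_field_derivative_def \<theta>'_def)
  qed
  show thesis
  proof (rule that[of "w \<circ> \<sigma>"])
    show "\<forall>\<tau>\<ge>0. (w \<circ> \<sigma>) (\<theta> \<tau>) = w \<tau>"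
      using \<sigma> by (metis \<theta>'_def comp_apply)
  next
    show "\<forall>t\<in>\<theta> ` {0..}. (w \<circ> \<sigma> has_vector_derivative F ((w \<circ> \<sigma>) t)) (at t within \<theta> ` {0..})"
    proof
      fix t assume "t \<in> \<theta> ` {0..}"
      then obtain \<tau> where t: "t = \<theta> \<tau>" "\<tau> \<ge> 0" by auto
      have \<sigma>t: "\<sigma> t = \<tau>" using \<sigma>[of \<tau>] t by (simp add: \<theta>'_def)
      have "(\<sigma> has_vector_derivative inverse (\<rho> \<tau>)) (at t within \<theta> ` {0..})"
        using d\<sigma>[OF t(2)] unfolding t(1) has_real_derivative_iff_has_vector_derivative[symmetric]
        by (rule has_field_derivative_at_within)
      from vector_diff_chain_within[OF this] w[OF t(2)]
      have "(w \<circ> \<sigma> has_vector_derivative inverse (\<rho> \<tau>) *\<^sub>R \<rho> \<tau> *\<^sub>R F (w \<tau>)) (at t within \<theta> ` {0..})"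
        unfolding \<sigma>img \<sigma>t by blast
      then show "(w \<circ> \<sigma> has_vector_derivative F ((w \<circ> \<sigma>) t)) (at t within \<theta> ` {0..})"
        using pos[OF t(2)] \<sigma>t by simp
    qed
  qed
qed

text \<open>Compactness bounds the Jacobian, and on a convex set the mean value inequality turns
  this bound into a Lipschitz constant.\<close>

lemma C1_on_lipschitz:
  assumes "C1_on S F" "compact S" "convex S"
  obtains L where "L-lipschitz_on S F"
proof -
  have der: "(F has_derivative (\<lambda>h. jacobian F (at x within S) *v h)) (at x within S)" if "x \<in> S" for x
    using assms(1) that by (auto simp: C1_on_def differentiable_on_def jacobian_works)
  have "bounded ((\<lambda>x. jacobian F (at x within S)) ` S)"
    using assms by (intro compact_imp_bounded compact_continuous_image) (auto simp: C1_on_def)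
  then obtain B where B: "\<And>x. x \<in> S \<Longrightarrow> norm (jacobian F (at x within S)) \<le> B"
    by (auto simp: bounded_iff)
  \<comment> \<open>The dimension factors bound the operator norm by the entries;
    \<open>max 0\<close> covers an empty \<open>S\<close>, where \<open>B\<close> may be
    negative.\<close>
  define K where "K = max 0 (real CARD('a) * real CARD('a) * B)"
  have "onorm ((*v) (jacobian F (at x within S))) \<le> K" if "x \<in> S" for x
  proof -
    have "\<bar>jacobian F (at x within S) $ i $ j\<bar> \<le> B" for i j
      using B[OF that] component_le_norm_cart[of "jacobian F (at x within S) $ i" j]
        Finite_Cartesian_Product.norm_nth_le[of "jacobian F (at x within S)" i] by linarith
    from onorm_le_matrix_component[OF this] show ?thesis unfolding K_def by linarith
  qed
  then have "K-lipschitz_on S F"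
    using differentiable_bound[OF \<open>convex S\<close> der]
    by (auto intro!: lipschitz_onI simp: dist_norm K_def)
  then show thesis by (rule that)
qed

section \<open>The quasi-parabolic compactification\<close>

locale quasi_parabolic =
  fixes \<alpha> \<beta> :: "'n::finite \<Rightarrow> nat" and c :: nat
  assumes alpha_pos: "\<alpha> i \<ge> 1" and beta_pos: "\<beta> i \<ge> 1"
    and c_pos: "c \<ge> 1" and alpha_beta: "\<alpha> i * \<beta> i = c"
begin

text \<open>This is \<open>p^(2c)\<close>. As a polynomial it is smooth everywhere and spares the
  proof the root in \<open>pfun\<close>.\<close>

definition P :: "real^'n \<Rightarrow> real" where
  "P x = (\<Sum>i\<in>UNIV. (x $ i) ^ (2 * \<beta> i))"

definition gradP :: "real^'n \<Rightarrow> real^'n" where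
  "gradP x = (\<chi> i. real (2 * \<beta> i) * (x $ i) ^ (2 * \<beta> i - 1))"

lemma P_nonneg: "P x \<ge> 0"
  by (simp add: P_def sum_nonneg power_mult)

lemma pfun_power: "pfun \<beta> c x ^ (2 * c) = P x"
  unfolding pfun_def P_def[symmetric] using c_pos P_nonneg by (intro real_root_pow_pos2) auto

lemma Dset_eq: "Dset \<beta> c = {x. P x < 1}"
  unfolding Dset_def pfun_def P_def[symmetric] using c_pos by simp

lemma P_zero [simp]: "P 0 = 0"
proof -
  have "2 * \<beta> i > 0" for i using beta_pos[of i] by linarith
  then show ?thesis by (simp add: P_def zero_power)
qed

lemma P_pos:
  assumes "x \<noteq> 0" shows "P x > 0"
proof -
  obtain i where "x $ i \<noteq> 0" using assms by (auto simp: vec_eq_iff)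
  then show ?thesis unfolding P_def
    by (intro sum_pos2[of _ i]) (auto simp: power_mult)
qed

text \<open>All exponents in \<open>P\<close> are at least 2. Together with
  \<open>P_scale_ge\<close> this replaces homogeneity along rays, which \<open>P\<close> has in
  general only for the weighted dilations.\<close>

lemma P_scale_le:
  assumes "0 \<le> s" "s \<le> 1" shows "P (s *\<^sub>R x) \<le> s * P x"
proof -
  have "s ^ (2 * \<beta> i) \<le> s" for i
    using power_decreasing[of 1 "2 * \<beta> i" s] assms beta_pos[of i] by simp
  then show ?thesis
    by (auto simp: P_def sum_distrib_left power_mult_distrib power_mult intro!: sum_mono mult_right_mono)
qed

lemma P_scale_ge:
  assumes "1 \<le> s" shows "s * P x \<le> P (s *\<^sub>R x)"
proof -
  have "s \<le> s ^ (2 * \<beta> i)" for i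
    using power_increasing[of 1 "2 * \<beta> i" s] assms beta_pos[of i] by simp
  then show ?thesis
    by (auto simp: P_def sum_distrib_left power_mult_distrib power_mult intro!: sum_mono mult_right_mono)
qed

lemma continuous_on_P [continuous_intros]:
  "continuous_on S h \<Longrightarrow> continuous_on S (\<lambda>x. P (h x))"
  unfolding P_def by (intro continuous_intros)

lemma has_derivative_P: "(P has_derivative (\<lambda>h. gradP x \<bullet> h)) (at x within S)"
  unfolding P_def
  by (rule derivative_eq_intros bounded_linear.has_derivative[OF bounded_linear_vec_nth] refl)+
    (auto simp: gradP_def inner_vec_def fun_eq_iff algebra_simps intro!: sum.cong)

lemma gradP_zero [simp]: "gradP 0 = 0"
proof -
  have "2 * \<beta> i - 1 > 0" for i using beta_pos[of i] by linarith
  then show ?thesis by (simp add: gradP_def vec_eq_iff zero_power)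
qed

section \<open>Topology and convexity of the domain\<close>

lemma open_Dset: "open (Dset \<beta> c)"
  unfolding Dset_eq by (intro open_Collect_less continuous_intros)

text \<open>\<open>P\<close> is a sum of even powers of the coordinates, hence convex.\<close>

lemma convex_Dset: "convex (Dset \<beta> c)"
  unfolding Dset_eq convex_alt
proof (intro ballI allI impI CollectI, elim conjE CollectE)
  fix x y :: "real^'n" and u :: real
  assume xy: "P x < 1" "P y < 1" and u: "0 \<le> u" "u \<le> 1"
  have "P ((1 - u) *\<^sub>R x + u *\<^sub>R y) \<le> (1 - u) * P x + u * P y"
    unfolding P_def sum_distrib_left sum.distrib[symmetric]
  proof (rule sum_mono)
    fix i
    show "((1 - u) *\<^sub>R x + u *\<^sub>R y) $ i ^ (2 * \<beta> i) \<le> (1 - u) * x $ i ^ (2 * \<beta> i) + u * y $ i ^ (2 * \<beta> i)"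
      using convex_onD[OF convex_power_even[of "2 * \<beta> i"] u, of "x $ i" "y $ i"] by simp
  qed
  also have "\<dots> < 1"
    using convex_bound_lt[of "P x" 1 "P y" "1 - u" u] xy u by simp
  finally show "P ((1 - u) *\<^sub>R x + u *\<^sub>R y) < 1" .
qed

text \<open>A point with \<open>P x \<le> 1\<close> is approached from inside along the segment from
  the origin, on which \<open>P_scale_le\<close> makes \<open>P\<close> smaller than 1.\<close>

lemma closure_Dset: "closure (Dset \<beta> c) = {x. P x \<le> 1}"
proof
  show "closure (Dset \<beta> c) \<subseteq> {x. P x \<le> 1}"
    unfolding Dset_eq by (rule closure_minimal) (auto intro!: closed_Collect_le continuous_intros)
  show "{x. P x \<le> 1} \<subseteq> closure (Dset \<beta> c)"
  proof
    fix x assume x: "x \<in> {x. P x \<le> 1}"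
    show "x \<in> closure (Dset \<beta> c)"
    proof (cases "x = 0")
      case True
      then show ?thesis using closure_subset by (fastforce simp: Dset_eq)
    next
      case False
      have "open_segment 0 x \<subseteq> Dset \<beta> c"
      proof
        fix z assume "z \<in> open_segment 0 x"
        then obtain s where s: "z = s *\<^sub>R x" "0 < s" "s < 1" by (auto simp: in_segment)
        then have "P z \<le> s * P x" using P_scale_le by simp
        also have "\<dots> \<le> s * 1" using s x by (intro mult_left_mono) auto
        finally show "z \<in> Dset \<beta> c" using s by (simp add: Dset_eq)
      qed
      then have "closure (open_segment 0 x) \<subseteq> closure (Dset \<beta> c)" by (rule closure_mono)
      then show ?thesis using False by (auto simp: closure_open_segment)
    qed
  qed
qed

lemma Eset_eq: "Eset \<beta> c = {x. P x = 1}"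
  unfolding Eset_def frontier_def closure_Dset interior_open[OF open_Dset] by (auto simp: Dset_eq)

lemma norm_le_of_P_le_1:
  assumes "P x \<le> 1" shows "norm x \<le> real CARD('n)"
proof -
  have "\<bar>x $ i\<bar> \<le> 1" for i
  proof (rule ccontr)
    assume "\<not> \<bar>x $ i\<bar> \<le> 1"
    then have "1 < \<bar>x $ i\<bar> ^ (2 * \<beta> i)"
      using beta_pos[of i] by (intro one_less_power) auto
    also have "\<dots> = x $ i ^ (2 * \<beta> i)" by (simp add: power_mult)
    also have "\<dots> \<le> P x"
      unfolding P_def by (intro member_le_sum) (auto simp: power_mult)
    finally show False using assms by simp
  qed
  then have "(\<Sum>i\<in>UNIV. \<bar>x $ i\<bar>) \<le> (\<Sum>i\<in>(UNIV::'n set). 1)" by (intro sum_mono) auto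
  then show ?thesis using norm_le_l1_cart[of x] by simp
qed

lemma compact_closure_Dset: "compact (closure (Dset \<beta> c))"
  unfolding compact_eq_bounded_closed closure_Dset bounded_iff
  using norm_le_of_P_le_1 by (auto intro!: closed_Collect_le continuous_intros)

text \<open>Along the ray through \<open>x\<close> the function \<open>P\<close> grows at least
  linearly, so the distance on that ray to the boundary is controlled by the defect of
  \<open>P x\<close> from 1.\<close>

lemma radial_point:
  assumes "x \<noteq> 0" "norm x \<le> R" "real CARD('n) \<le> R"
  obtains z where "P z = 1" "norm (x - z) \<le> R * \<bar>1 - P x\<bar>"
proof -
  have Px: "P x > 0" using assms by (simp add: P_pos)
  have c: "continuous_on {a..b} (\<lambda>s. P (s *\<^sub>R x))" for a b by (intro continuous_intros)
  show thesis
  proof (cases "P x \<ge> 1")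
    case True
    then obtain s where s: "0 \<le> s" "s \<le> 1" "P (s *\<^sub>R x) = 1"
      using IVT'[of "\<lambda>s. P (s *\<^sub>R x)" 0 1 1] c by auto
    have "1 \<le> s * P x" using P_scale_le[OF s(1,2), of x] s by simp
    then have "1 / P x \<le> s" using Px by (simp add: field_simps)
    \<comment> \<open>With \<open>q = P x\<close>, the two sides differ by
      \<open>(q - 1)^2 / q\<close>.\<close>
    moreover have "1 - 1 / P x \<le> P x - 1"
    proof -
      have "(P x - 1)\<^sup>2 / P x \<ge> 0" using Px by simp
      then show ?thesis using Px by (simp add: field_simps power2_eq_square)
    qed
    ultimately have "1 - s \<le> \<bar>1 - P x\<bar>" by linarith
    then have "(1 - s) * norm x \<le> \<bar>1 - P x\<bar> * R" using assms s by (intro mult_mono) auto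
    moreover have "x - s *\<^sub>R x = (1 - s) *\<^sub>R x" by (simp add: algebra_simps)
    ultimately show ?thesis using s by (intro that[of "s *\<^sub>R x"]) (simp_all add: mult.commute)
  next
    case False
    then have "1 / P x \<ge> 1" using Px by simp
    then have "1 \<le> P ((1 / P x) *\<^sub>R x)" using P_scale_ge[of "1 / P x" x] Px by simp
    then obtain s where s: "1 \<le> s" "P (s *\<^sub>R x) = 1"
      using IVT'[of "\<lambda>s. P (s *\<^sub>R x)" 1 1 "1 / P x"] c False \<open>1 / P x \<ge> 1\<close> by auto
    have "s * P x \<le> 1" using P_scale_ge[OF s(1), of x] s by simp
    then have "(s - 1) / s \<le> 1 - P x" using s by (simp add: field_simps)
    \<comment> \<open>The boundary point \<open>s *\<^sub>R x\<close> has norm at most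
      \<open>R\<close>; the denominator \<open>s\<close> brings the estimate back to
      \<open>norm x\<close>.\<close>
    then have "(s - 1) / s * norm (s *\<^sub>R x) \<le> \<bar>1 - P x\<bar> * R"
      using assms(3) norm_le_of_P_le_1[of "s *\<^sub>R x"] s by (intro mult_mono) auto
    moreover have "norm (x - s *\<^sub>R x) = (s - 1) * norm x"
    proof -
      have "x - s *\<^sub>R x = - ((s - 1) *\<^sub>R x)" by (simp add: algebra_simps)
      then show ?thesis using s by simp
    qed
    ultimately show ?thesis using s by (intro that[of "s *\<^sub>R x"]) (simp_all add: mult.commute)
  qed
qed

text \<open>Each component of \<open>gradP\<close> depends on one coordinate only, so the
  one-variable mean value bound on \<open>[-R, R]\<close> suffices.\<close>

lemma gradP_lipschitz:
  obtains K where "K-lipschitz_on (cball 0 R) gradP"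
proof -
  define M where "M i = real (2 * \<beta> i) * (real (2 * \<beta> i - 1) * R ^ (2 * \<beta> i - 1 - 1))" for i
  \<comment> \<open>The absolute values keep \<open>K\<close> nonnegative also for negative
    \<open>R\<close>, when the ball is empty.\<close>
  define K where "K = (\<Sum>i\<in>UNIV. \<bar>M i\<bar>)"
  have "norm (gradP x - gradP y) \<le> K * norm (x - y)" if xy: "x \<in> cball 0 R" "y \<in> cball 0 R" for x y
  proof -
    have comp: "\<bar>(gradP x - gradP y) $ i\<bar> \<le> \<bar>M i\<bar> * norm (x - y)" for i
    proof -
      have "x $ i \<in> {-R..R}" "y $ i \<in> {-R..R}"
        using xy component_le_norm_cart[of x i] component_le_norm_cart[of y i] by (auto simp: abs_le_iff)
      then have "norm (real (2 * \<beta> i) * x $ i ^ (2 * \<beta> i - 1) - real (2 * \<beta> i) * y $ i ^ (2 * \<beta> i - 1))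
          \<le> M i * norm (x $ i - y $ i)"
      proof (rule field_differentiable_bound[rotated 3])
        fix z assume z: "z \<in> {-R..R}"
        show "((\<lambda>z. real (2 * \<beta> i) * z ^ (2 * \<beta> i - 1)) has_real_derivative
            real (2 * \<beta> i) * (real (2 * \<beta> i - 1) * z ^ (2 * \<beta> i - 1 - 1))) (at z within {-R..R})"
          by (auto intro!: derivative_eq_intros)
        have "\<bar>z\<bar> ^ (2 * \<beta> i - 1 - 1) \<le> R ^ (2 * \<beta> i - 1 - 1)"
          using z by (intro power_mono) auto
        then show "norm (real (2 * \<beta> i) * (real (2 * \<beta> i - 1) * z ^ (2 * \<beta> i - 1 - 1))) \<le> M i"
          by (simp add: M_def abs_mult power_abs mult_left_mono)
      qed auto
      also have "\<dots> \<le> \<bar>M i\<bar> * norm (x - y)"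
        using component_le_norm_cart[of "x - y" i] by (intro mult_mono) auto
      finally show ?thesis by (simp add: gradP_def)
    qed
    have "norm (gradP x - gradP y) \<le> (\<Sum>i\<in>UNIV. \<bar>(gradP x - gradP y) $ i\<bar>)"
      by (rule norm_le_l1_cart)
    also have "\<dots> \<le> (\<Sum>i\<in>UNIV. \<bar>M i\<bar> * norm (x - y))" by (intro sum_mono comp)
    finally show ?thesis by (simp add: K_def sum_distrib_right)
  qed
  then have "K-lipschitz_on (cball 0 R) gradP"
    by (intro lipschitz_onI) (auto simp: dist_norm K_def sum_nonneg)
  then show thesis by (rule that)
qed

text \<open>The product \<open>gradP x \<bullet> G x\<close> is Lipschitz on balls and vanishes
  where \<open>P = 1\<close>, so it is bounded by the distance to that set, which
  \<open>radial_point\<close> estimates.\<close>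

lemma tangent_rate_bound:
  fixes G :: "real^'n \<Rightarrow> real^'n"
  assumes lip: "L-lipschitz_on UNIV G" and tang: "\<And>z. P z = 1 \<Longrightarrow> gradP z \<bullet> G z = 0"
  obtains K where "\<And>x. norm x \<le> R \<Longrightarrow> \<bar>gradP x \<bullet> G x\<bar> \<le> K * \<bar>1 - P x\<bar>"
proof -
  define r where "r = max R (real CARD('n))"
  have r: "R \<le> r" "real CARD('n) \<le> r" "r \<ge> 0" by (auto simp: r_def)
  obtain Kg where Kg: "Kg-lipschitz_on (cball 0 r) gradP" by (rule gradP_lipschitz)
  note nn = lipschitz_on_nonneg[OF Kg] lipschitz_on_nonneg[OF lip]
  define M where "M = norm (G 0) + L * r"
  have G: "norm (G x) \<le> M" if "norm x \<le> r" for x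
  proof -
    have "norm (G x) \<le> norm (G 0) + norm (G x - G 0)" using norm_triangle_sub[of "G x" "G 0"] by simp
    also have "norm (G x - G 0) \<le> L * norm x"
      using lipschitz_onD[OF lip, of x 0] by (simp add: dist_norm)
    also have "\<dots> \<le> L * r" using that nn by (intro mult_left_mono) auto
    finally show ?thesis by (simp add: M_def)
  qed
  have g: "norm (gradP x) \<le> Kg * r" if "norm x \<le> r" for x
  proof -
    have "norm (gradP x) \<le> Kg * norm x"
      using lipschitz_onD[OF Kg, of x 0] that r by (simp add: dist_norm)
    also have "\<dots> \<le> Kg * r" using that nn by (intro mult_left_mono) auto
    finally show ?thesis .
  qed
  define K where "K = Kg * M + Kg * r * L"
  have "M \<ge> 0" using nn r by (simp add: M_def)
  then have "K \<ge> 0" using nn r by (simp add: K_def)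
  show thesis
  proof (rule that)
    fix x :: "real^'n" assume "norm x \<le> R"
    then have x: "norm x \<le> r" using r by simp
    show "\<bar>gradP x \<bullet> G x\<bar> \<le> (K * r) * \<bar>1 - P x\<bar>"
    proof (cases "x = 0")
      \<comment> \<open>The origin has no radial boundary point, but \<open>gradP\<close> vanishes
        there.\<close>
      case True
      then show ?thesis using \<open>K \<ge> 0\<close> r by simp
    next
      case False
      then obtain z where z: "P z = 1" "norm (x - z) \<le> r * \<bar>1 - P x\<bar>"
        using radial_point x r by blast
      have zr: "norm z \<le> r" using norm_le_of_P_le_1[of z] z r by simp
      \<comment> \<open>The subtracted product \<open>gradP z \<bullet> G z\<close> is zero by
        tangency.\<close>
      have "gradP x \<bullet> G x = (gradP x - gradP z) \<bullet> G x + gradP z \<bullet> (G x - G z)"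
        using tang[OF z(1)] by (simp add: algebra_simps)
      also have "\<bar>\<dots>\<bar> \<le> norm (gradP x - gradP z) * norm (G x) + norm (gradP z) * norm (G x - G z)"
        by (intro order_trans[OF abs_triangle_ineq] add_mono Cauchy_Schwarz_ineq2)
      also have "\<dots> \<le> (Kg * norm (x - z)) * M + (Kg * r) * (L * norm (x - z))"
        using lipschitz_onD[OF Kg, of x z] lipschitz_onD[OF lip, of x z] x zr nn r
        by (intro add_mono mult_mono G g) (auto simp: dist_norm)
      also have "\<dots> = K * norm (x - z)" by (simp add: K_def algebra_simps)
      also have "\<dots> \<le> K * (r * \<bar>1 - P x\<bar>)" using z \<open>K \<ge> 0\<close> by (intro mult_left_mono)
      finally show ?thesis by (simp add: mult.assoc)
    qed
  qed
qed

text \<open>On a compact time interval the trajectory is bounded, so \<open>1 - P\<close> changes at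
  a rate at most proportional to itself. Inside, boundary and outside are therefore each
  invariant.\<close>

lemma sgn_one_minus_P_invariant:
  fixes G :: "real^'n \<Rightarrow> real^'n"
  assumes lip: "L-lipschitz_on UNIV G" and tang: "\<And>z. P z = 1 \<Longrightarrow> gradP z \<bullet> G z = 0"
    and "0 \<le> T"
    and x: "\<And>t. t \<in> {0..T} \<Longrightarrow> (x has_vector_derivative G (x t)) (at t within {0..T})"
  shows "sgn (1 - P (x T)) = sgn (1 - P (x 0))"
proof -
  have "continuous_on {0..T} x"
    using x by (rule continuous_on_vector_derivative)
  then have "bounded (x ` {0..T})"
    by (intro compact_imp_bounded compact_continuous_image) auto
  then obtain R where "\<forall>v\<in>x ` {0..T}. norm v \<le> R" unfolding bounded_iff by blast
  then have R: "norm (x t) \<le> R" if "t \<in> {0..T}" for t using that by blast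
  obtain K where K: "\<And>x. norm x \<le> R \<Longrightarrow> \<bar>gradP x \<bullet> G x\<bar> \<le> K * \<bar>1 - P x\<bar>"
    using tangent_rate_bound[OF lip tang, where R = R] by blast
  show ?thesis
  proof (rule linear_rate_preserves_sign[OF \<open>0 \<le> T\<close>, where u = "\<lambda>t. 1 - P (x t)" and K = K])
    fix t assume t: "t \<in> {0..T}"
    have "((\<lambda>t. P (x t)) has_derivative (\<lambda>h. gradP (x t) \<bullet> (h *\<^sub>R G (x t)))) (at t within {0..T})"
      using x[OF t] has_derivative_P unfolding has_vector_derivative_def
      by (rule has_derivative_compose)
    then have "((\<lambda>t. P (x t)) has_real_derivative gradP (x t) \<bullet> G (x t)) (at t within {0..T})"
      unfolding has_field_derivative_def by (simp add: mult_commute_abs)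
    then show "((\<lambda>t. 1 - P (x t)) has_real_derivative - (gradP (x t) \<bullet> G (x t))) (at t within {0..T})"
      by (auto intro!: derivative_eq_intros)
    show "\<bar>- (gradP (x t) \<bullet> G (x t))\<bar> \<le> K * \<bar>1 - P (x t)\<bar>"
      using K[OF R[OF t]] by simp
  qed
qed

section \<open>Weighted dilations and bijectivity of the compactification\<close>

lemma beta_alpha: "real (2 * \<beta> i) * real (\<alpha> i) = 2 * real c"
  using alpha_beta[of i] by (metis mult.assoc mult.commute of_nat_mult of_nat_numeral)

lemma P_dil: "P (dil \<alpha> r x) = r ^ (2 * c) * P x"
proof -
  have "(r ^ \<alpha> i) ^ (2 * \<beta> i) = r ^ (2 * c)" for i
  proof -
    have "(r ^ \<alpha> i) ^ (2 * \<beta> i) = r ^ (\<alpha> i * (2 * \<beta> i))" by (simp only: power_mult)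
    also have "\<alpha> i * (2 * \<beta> i) = 2 * c" using alpha_beta[of i] by simp
    finally show ?thesis .
  qed
  then show ?thesis by (simp add: P_def dil_def power_mult_distrib sum_distrib_left)
qed

lemma T_para_inv_nth: "T_para_inv \<alpha> \<beta> c x $ j = x $ j / (1 - P x) ^ \<alpha> j"
  by (simp add: T_para_inv_def pfun_power)

lemma T_para_inv_eq_dil: "T_para_inv \<alpha> \<beta> c x = dil \<alpha> (inverse (1 - P x)) x"
  by (simp add: vec_eq_iff T_para_inv_nth dil_def power_inverse divide_inverse mult.commute)

lemma dil_dil: "dil \<alpha> r (dil \<alpha> s x) = dil \<alpha> (r * s) x"
  by (simp add: dil_def vec_eq_iff power_mult_distrib)

lemma dil_one: "dil \<alpha> 1 x = x"
  by (simp add: dil_def vec_eq_iff)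

text \<open>Weighted homogeneity combined with \<open>\<kappa> * P x = \<kappa> - 1\<close>.
  Inverting the compactification thereby reduces to one scalar equation for
  \<open>\<kappa>\<close>.\<close>

lemma P_T_para_inv:
  assumes "P x < 1" and "\<kappa> = inverse (1 - P x)"
  shows "P (T_para_inv \<alpha> \<beta> c x) = \<kappa> ^ (2 * c - 1) * (\<kappa> - 1)"
proof -
  have "\<kappa> * P x = \<kappa> - 1" using assms by (simp add: field_simps)
  have "2 * c = Suc (2 * c - 1)" using c_pos by simp
  then have "P (T_para_inv \<alpha> \<beta> c x) = \<kappa> ^ (2 * c - 1) * (\<kappa> * P x)"
    unfolding T_para_inv_eq_dil P_dil assms(2)[symmetric] by (metis power_Suc mult.assoc mult.commute)
  then show ?thesis using \<open>\<kappa> * P x = \<kappa> - 1\<close> by simp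
qed

text \<open>The scalar function of \<open>\<kappa>\<close> is strictly increasing on
  \<open>[1, \<infinity>)\<close>, so the image determines \<open>\<kappa>\<close>, and dilating the
  image by \<open>1 / \<kappa>\<close> recovers the point.\<close>

lemma inj_on_T_para_inv: "inj_on (T_para_inv \<alpha> \<beta> c) (Dset \<beta> c)"
proof
  fix x z assume "x \<in> Dset \<beta> c" "z \<in> Dset \<beta> c" and eq: "T_para_inv \<alpha> \<beta> c x = T_para_inv \<alpha> \<beta> c z"
  then have P1: "P x < 1" "P z < 1" by (auto simp: Dset_eq)
  define \<kappa> where "\<kappa> x = inverse (1 - P x)" for x
  have ge1: "\<kappa> x \<ge> 1" "\<kappa> z \<ge> 1" using P1 P_nonneg[of x] P_nonneg[of z] by (auto simp: \<kappa>_def field_simps)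
  have mono: "a ^ (2 * c - 1) * (a - 1) < b ^ (2 * c - 1) * (b - 1)" if "1 \<le> a" "a < b" for a b :: real
  proof -
    have "a ^ (2 * c - 1) * (a - 1) \<le> b ^ (2 * c - 1) * (a - 1)"
      using that by (intro mult_right_mono power_mono) auto
    also have "\<dots> < b ^ (2 * c - 1) * (b - 1)" using that by (intro mult_strict_left_mono) auto
    finally show ?thesis .
  qed
  have "\<kappa> x ^ (2 * c - 1) * (\<kappa> x - 1) = \<kappa> z ^ (2 * c - 1) * (\<kappa> z - 1)"
    using P_T_para_inv[OF P1(1) \<kappa>_def] P_T_para_inv[OF P1(2) \<kappa>_def] eq by simp
  then have "\<kappa> x = \<kappa> z"
    using mono[OF ge1(1)] mono[OF ge1(2)] by (metis less_irrefl linorder_neqE_linordered_idom)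
  moreover have "\<kappa> x \<noteq> 0" using ge1 by auto
  moreover have "w = dil \<alpha> (inverse (\<kappa> w)) (T_para_inv \<alpha> \<beta> c w)" if "\<kappa> w \<noteq> 0" for w
    using that by (simp add: T_para_inv_eq_dil dil_dil \<kappa>_def[symmetric] dil_one)
  ultimately show "x = z" using eq by metis
qed

text \<open>The scalar function is 0 at 1 and at least \<open>P y\<close> at \<open>1 + P y\<close>;
  the intermediate value theorem gives \<open>\<kappa>\<close>, and the preimage is \<open>y\<close>
  dilated by \<open>1 / \<kappa>\<close>.\<close>

lemma T_para_inv_surj:
  obtains x where "x \<in> Dset \<beta> c" "T_para_inv \<alpha> \<beta> c x = y"
proof -
  define \<phi> where "\<phi> \<kappa> = \<kappa> ^ (2 * c - 1) * (\<kappa> - 1)" for \<kappa> :: real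
  have "\<phi> 1 \<le> P y" by (simp add: \<phi>_def P_nonneg)
  moreover have "P y \<le> \<phi> (1 + P y)"
    using mult_right_mono[OF one_le_power[of "1 + P y" "2 * c - 1"] P_nonneg[of y]] P_nonneg[of y]
    by (simp add: \<phi>_def)
  moreover have "continuous_on {1..1 + P y} \<phi>" unfolding \<phi>_def by (intro continuous_intros)
  ultimately obtain \<kappa> where \<kappa>: "1 \<le> \<kappa>" "\<phi> \<kappa> = P y"
    using IVT'[of \<phi> 1 "P y" "1 + P y"] P_nonneg[of y] by auto
  define x where "x = dil \<alpha> (inverse \<kappa>) y"
  have "\<kappa> ^ (2 * c) = \<kappa> ^ (2 * c - 1) * \<kappa>"
    using c_pos power_Suc2[of \<kappa> "2 * c - 1"] by simp
  then have "P x = (\<kappa> - 1) / \<kappa>"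
    unfolding x_def P_dil \<kappa>(2)[symmetric] \<phi>_def using \<kappa> by (simp add: field_simps)
  then have Px: "1 - P x = inverse \<kappa>" using \<kappa> by (simp add: field_simps)
  show thesis
  proof
    have "1 - P x > 0" unfolding Px using \<kappa> by simp
    then show "x \<in> Dset \<beta> c" by (simp add: Dset_eq)
    show "T_para_inv \<alpha> \<beta> c x = y"
      unfolding T_para_inv_eq_dil Px using \<kappa> by (simp add: x_def dil_dil dil_one)
  qed
qed

lemma T_para_in_Dset: "T_para \<alpha> \<beta> c y \<in> Dset \<beta> c"
  and T_para_inv_T_para: "T_para_inv \<alpha> \<beta> c (T_para \<alpha> \<beta> c y) = y"
proof -
  obtain x where x: "x \<in> Dset \<beta> c" "T_para_inv \<alpha> \<beta> c x = y" by (rule T_para_inv_surj)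
  then have "T_para \<alpha> \<beta> c y = x"
    unfolding T_para_def using the_inv_into_f_f[OF inj_on_T_para_inv] by blast
  then show "T_para \<alpha> \<beta> c y \<in> Dset \<beta> c" "T_para_inv \<alpha> \<beta> c (T_para \<alpha> \<beta> c y) = y"
    using x by simp_all
qed

section \<open>The time factor and the desingularized field\<close>

lemma time_factor_eq: "time_factor \<beta> c x = 1 - (2 * real c - 1) / (2 * real c) * (1 - P x)"
  by (simp add: time_factor_def pfun_power)

lemma time_factor_pos: "0 < time_factor \<beta> c x"
proof -
  have "time_factor \<beta> c x = 1 / (2 * real c) + (2 * real c - 1) / (2 * real c) * P x"
    using c_pos by (simp add: time_factor_eq field_simps)
  also have "\<dots> > 0"
    using c_pos P_nonneg[of x] by (intro add_pos_nonneg mult_nonneg_nonneg) auto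
  finally show ?thesis .
qed

lemma time_factor_le_1: "P x \<le> 1 \<Longrightarrow> time_factor \<beta> c x \<le> 1"
  using c_pos by (simp add: time_factor_eq)

lemma continuous_on_time_factor [continuous_intros]:
  "continuous_on S h \<Longrightarrow> continuous_on S (\<lambda>x. time_factor \<beta> c (h x))"
  unfolding time_factor_eq by (intro continuous_intros)

text \<open>The sum in the second term of \<open>desing_field\<close>, named because
  \<open>(1 - P x) * S_sum k f x\<close> turns out to be the derivative of \<open>P\<close> along
  the field.\<close>

definition S_sum :: "nat \<Rightarrow> (real^'n \<Rightarrow> real^'n) \<Rightarrow> real^'n \<Rightarrow> real" where
  "S_sum k f x = (\<Sum>j\<in>UNIV. (x $ j) ^ (2 * \<beta> j - 1) / real (\<alpha> j) * f_tilde \<alpha> \<beta> c k f x $ j)"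

lemma desing_field_nth:
  "desing_field \<alpha> \<beta> c k f x $ i =
     time_factor \<beta> c x * f_tilde \<alpha> \<beta> c k f x $ i - real (\<alpha> i) * x $ i * S_sum k f x"
  by (simp add: desing_field_def S_sum_def)

text \<open>An algebraic identity: tangency at the boundary does not depend on the value that the \<open>Lim\<close> in
  \<^const>\<open>f_tilde\<close> takes there.\<close>

lemma gradP_desing_field: "gradP x \<bullet> desing_field \<alpha> \<beta> c k f x = (1 - P x) * S_sum k f x"
proof -
  let ?f = "f_tilde \<alpha> \<beta> c k f x" and ?s = "S_sum k f x" and ?t = "time_factor \<beta> c x"
  have "gradP x $ i * desing_field \<alpha> \<beta> c k f x $ i =
      2 * real c * (?t * (x $ i ^ (2 * \<beta> i - 1) / real (\<alpha> i) * ?f $ i) - x $ i ^ (2 * \<beta> i) * ?s)" for i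
  proof -
    \<comment> \<open>Writing \<open>2 \<beta> i\<close> as \<open>2 c / \<alpha> i\<close> gives
      all coordinates the common factor \<open>2 c\<close>, so that the sums reassemble to
      \<open>S_sum\<close> and \<open>P\<close>.\<close>
    have b: "real (2 * \<beta> i) = 2 * real c / real (\<alpha> i)"
      using beta_alpha[of i] alpha_pos[of i] by (simp add: field_simps)
    have "x $ i ^ (2 * \<beta> i) = x $ i ^ (2 * \<beta> i - 1) * x $ i"
      using beta_pos[of i] power_Suc2[of "x $ i" "2 * \<beta> i - 1"] by simp
    then show ?thesis
      using alpha_pos[of i] unfolding gradP_def desing_field_nth vec_lambda_beta b
      by (simp add: field_simps)
  qed
  then have "gradP x \<bullet> desing_field \<alpha> \<beta> c k f x =
      (\<Sum>i\<in>UNIV. 2 * real c * (?t * (x $ i ^ (2 * \<beta> i - 1) / real (\<alpha> i) * ?f $ i) - x $ i ^ (2 * \<beta> i) * ?s))"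
    by (simp add: inner_vec_def)
  also have "\<dots> = 2 * real c * (?t * (\<Sum>i\<in>UNIV. x $ i ^ (2 * \<beta> i - 1) / real (\<alpha> i) * ?f $ i)
      - (\<Sum>i\<in>UNIV. x $ i ^ (2 * \<beta> i)) * ?s)"
    by (simp only: sum_distrib_left sum_distrib_right sum_subtractf right_diff_distrib)
  also have "\<dots> = 2 * real c * (?t * ?s - P x * ?s)"
    by (simp only: S_sum_def P_def)
  \<comment> \<open>The constant in \<open>time_factor\<close> is made for this:
    \<open>2 c (time_factor - P) = 1 - P\<close>.\<close>
  also have "\<dots> = (1 - P x) * ?s"
    using c_pos by (simp add: time_factor_eq field_simps)
  finally show ?thesis .
qed

lemma f_tilde_Dset:
  assumes "P x < 1"
  shows "f_tilde \<alpha> \<beta> c k f x $ j = f (T_para_inv \<alpha> \<beta> c x) $ j * (1 - P x) ^ (k + \<alpha> j)"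
  using assms unfolding T_para_inv_eq_dil
  by (simp add: f_tilde_def f_tilde_int_def Dset_eq kappa_def pfun_power divide_inverse power_inverse)

text \<open>Differentiating the denominators by means of \<open>gradP_desing_field\<close> produces
  exactly the term that cancels the second part of the field; what remains is \<open>f\<close> times
  the rate \<open>dt/d\<tau>\<close>.\<close>

lemma has_vector_derivative_T_para_inv:
  assumes x: "(x has_vector_derivative desing_field \<alpha> \<beta> c k f (x t)) (at t within I)"
    and D: "P (x t) < 1"
  shows "((\<lambda>t. T_para_inv \<alpha> \<beta> c (x t)) has_vector_derivative
     (time_factor \<beta> c (x t) * (1 - P (x t)) ^ k) *\<^sub>R f (T_para_inv \<alpha> \<beta> c (x t))) (at t within I)"
proof -
  define u s where "u = 1 - P (x t)" and "s = S_sum k f (x t)"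
  have u: "u > 0" using D by (simp add: u_def)
  have "((\<lambda>t. P (x t)) has_derivative (\<lambda>h. gradP (x t) \<bullet> (h *\<^sub>R desing_field \<alpha> \<beta> c k f (x t)))) (at t within I)"
    using x has_derivative_P unfolding has_vector_derivative_def by (rule has_derivative_compose)
  then have "((\<lambda>t. P (x t)) has_real_derivative u * s) (at t within I)"
    unfolding has_field_derivative_def
    by (simp add: gradP_desing_field u_def s_def mult_commute_abs)
  then have du: "((\<lambda>t. 1 - P (x t)) has_real_derivative - (u * s)) (at t within I)"
    by (auto intro!: derivative_eq_intros)
  show ?thesis
  unfolding has_vector_derivative_def
  proof (rule has_derivative_componentwise_within[THEN iffD2], intro ballI)
    fix b :: "real^'n" assume "b \<in> Basis"
    then obtain j where b: "b = axis j 1" by (auto simp: Basis_vec_def)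
    have dx: "((\<lambda>t. x t $ j) has_real_derivative desing_field \<alpha> \<beta> c k f (x t) $ j) (at t within I)"
      unfolding has_real_derivative_iff_has_vector_derivative
      using bounded_linear.has_vector_derivative[OF bounded_linear_vec_nth x] .
    let ?a = "\<alpha> j"
    have ua: "u ^ ?a = u * u ^ (?a - 1)"
      using alpha_pos[of j] power_Suc[of u "?a - 1"] by simp
    have "((\<lambda>t. x t $ j / (1 - P (x t)) ^ ?a) has_real_derivative
        (desing_field \<alpha> \<beta> c k f (x t) $ j * u ^ ?a - x t $ j * (real ?a * (u ^ (?a - 1) * - (u * s)))) /
          (u ^ ?a * u ^ ?a)) (at t within I)"
      unfolding u_def using u
      by (intro DERIV_divide dx DERIV_power[OF du[unfolded u_def], THEN DERIV_cong]) (auto simp: u_def)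
    moreover have "(desing_field \<alpha> \<beta> c k f (x t) $ j * u ^ ?a - x t $ j * (real ?a * (u ^ (?a - 1) * - (u * s)))) /
          (u ^ ?a * u ^ ?a) = (desing_field \<alpha> \<beta> c k f (x t) $ j + real ?a * x t $ j * s) / u ^ ?a"
      using u unfolding ua by (simp add: field_simps)
    \<comment> \<open>\<open>f_tilde\<close> contributes the power \<open>k + \<alpha> j\<close> of
      \<open>u\<close>; division by \<open>u ^ \<alpha> j\<close> leaves
      \<open>u ^ k\<close>.\<close>
    moreover have "\<dots> = time_factor \<beta> c (x t) * u ^ k * f (T_para_inv \<alpha> \<beta> c (x t)) $ j"
      using u by (simp add: desing_field_nth f_tilde_Dset[OF D] s_def[symmetric] u_def[symmetric] power_add)
    ultimately have "((\<lambda>t. x t $ j / (1 - P (x t)) ^ ?a) has_real_derivative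
        time_factor \<beta> c (x t) * u ^ k * f (T_para_inv \<alpha> \<beta> c (x t)) $ j) (at t within I)"
      by simp
    then show "((\<lambda>t. T_para_inv \<alpha> \<beta> c (x t) \<bullet> b) has_derivative
       (\<lambda>h. (h *\<^sub>R ((time_factor \<beta> c (x t) * (1 - P (x t)) ^ k) *\<^sub>R f (T_para_inv \<alpha> \<beta> c (x t)))) \<bullet> b)) (at t within I)"
      unfolding has_field_derivative_def b
      by (simp add: T_para_inv_nth inner_axis u_def mult_commute_abs mult.assoc)
  qed
qed

text \<open>Composing with the nearest-point projection, which is nonexpansive because the closed
  domain is convex, extends the field to the whole space with the same Lipschitz constant and the
  same values on the domain.\<close>

lemma lipschitz_tangent_extension:
  fixes g :: "real^'n \<Rightarrow> real^'n"
  assumes g: "C1_on (closure (Dset \<beta> c)) g" and tang: "\<And>z. P z = 1 \<Longrightarrow> gradP z \<bullet> g z = 0"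
  obtains G L where "L-lipschitz_on UNIV G" "bounded (range G)"
    "\<forall>x. P x \<le> 1 \<longrightarrow> G x = g x" "\<forall>z. P z = 1 \<longrightarrow> gradP z \<bullet> G z = 0"
proof -
  let ?S = "closure (Dset \<beta> c)"
  have conv: "convex ?S" by (rule convex_closure[OF convex_Dset])
  have ne: "?S \<noteq> {}" unfolding closure_Dset using P_zero by (metis empty_iff mem_Collect_eq zero_le_one)
  obtain L where L: "L-lipschitz_on ?S g" by (rule C1_on_lipschitz[OF g compact_closure_Dset conv])
  have cp: "closest_point ?S x \<in> ?S" for x
    by (rule closest_point_in_set[OF closed_closure ne])
  show thesis
  proof (rule that)
    show "L-lipschitz_on UNIV (g \<circ> closest_point ?S)"
    proof (rule lipschitz_onI)
      fix x y
      have "dist (g (closest_point ?S x)) (g (closest_point ?S y)) \<le> L * dist (closest_point ?S x) (closest_point ?S y)"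
        by (rule lipschitz_onD[OF L cp cp])
      also have "\<dots> \<le> L * dist x y"
        by (intro mult_left_mono closest_point_lipschitz conv closed_closure ne lipschitz_on_nonneg[OF L])
      finally show "dist ((g \<circ> closest_point ?S) x) ((g \<circ> closest_point ?S) y) \<le> L * dist x y" by simp
    qed (rule lipschitz_on_nonneg[OF L])
    have "bounded (g ` ?S)"
      by (intro compact_imp_bounded compact_continuous_image compact_closure_Dset lipschitz_on_continuous_on[OF L])
    then show "bounded (range (g \<circ> closest_point ?S))"
      by (rule bounded_subset) (use cp in auto)
    show eq: "\<forall>x. P x \<le> 1 \<longrightarrow> (g \<circ> closest_point ?S) x = g x"
      using closest_point_self[of _ ?S] by (simp add: closure_Dset)
    then show "\<forall>z. P z = 1 \<longrightarrow> gradP z \<bullet> (g \<circ> closest_point ?S) z = 0"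
      using tang by simp
  qed
qed

text \<open>A solution of the original field also solves the extended one, for which the sign of
  \<open>1 - P\<close> is invariant.\<close>

lemma ode_solution_tangent_stays_in_Dset:
  fixes g :: "real^'n \<Rightarrow> real^'n"
  assumes g: "C1_on (closure (Dset \<beta> c)) g" and tang: "\<And>z. P z = 1 \<Longrightarrow> gradP z \<bullet> g z = 0"
    and sol: "ode_solution g (closure (Dset \<beta> c)) x0 {0..} x" and "P x0 < 1" "0 \<le> t"
  shows "P (x t) < 1"
proof -
  obtain G L where G: "L-lipschitz_on UNIV G" "bounded (range G)"
    "\<forall>x. P x \<le> 1 \<longrightarrow> G x = g x" "\<forall>z. P z = 1 \<longrightarrow> gradP z \<bullet> G z = 0"
    by (rule lipschitz_tangent_extension[OF g tang])
  have "sgn (1 - P (x t)) = sgn (1 - P (x 0))"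
  proof (rule sgn_one_minus_P_invariant[OF G(1) G(4)[rule_format] \<open>0 \<le> t\<close>])
    fix s assume s: "s \<in> {0..t}"
    then have "P (x s) \<le> 1" "(x has_vector_derivative g (x s)) (at s within {0..})"
      using sol by (auto simp: ode_solution_def closure_Dset)
    then show "(x has_vector_derivative G (x s)) (at s within {0..t})"
      using has_vector_derivative_within_subset[of x "g (x s)" s "{0..}" "{0..t}"] G(3) by auto
  qed
  then show ?thesis using sol \<open>P x0 < 1\<close> by (simp add: ode_solution_def sgn_if split: if_splits)
qed

text \<open>The extended field has a global solution; sign invariance confines it to the closed
  domain, where both fields agree. Starting points on the boundary are included.\<close>

lemma ode_solution_tangent_exists:
  fixes g :: "real^'n \<Rightarrow> real^'n"
  assumes g: "C1_on (closure (Dset \<beta> c)) g" and tang: "\<And>z. P z = 1 \<Longrightarrow> gradP z \<bullet> g z = 0"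
    and x0: "x0 \<in> closure (Dset \<beta> c)"
  obtains x where "ode_solution g (closure (Dset \<beta> c)) x0 {0..} x"
proof -
  obtain G L where G: "L-lipschitz_on UNIV G" "bounded (range G)"
    "\<forall>x. P x \<le> 1 \<longrightarrow> G x = g x" "\<forall>z. P z = 1 \<longrightarrow> gradP z \<bullet> G z = 0"
    by (rule lipschitz_tangent_extension[OF g tang])
  obtain x where x: "x 0 = x0" "\<forall>t\<ge>0. (x has_vector_derivative G (x t)) (at t within {0..})"
    by (rule ode_global_existence[OF G(1,2)])
  have P: "P (x t) \<le> 1" if "t \<ge> 0" for t
  proof -
    have "sgn (1 - P (x t)) = sgn (1 - P (x 0))"
    proof (rule sgn_one_minus_P_invariant[OF G(1) G(4)[rule_format] that])
      fix s assume s: "s \<in> {0..t}"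
      then show "(x has_vector_derivative G (x s)) (at s within {0..t})"
        using has_vector_derivative_within_subset[of x "G (x s)" s "{0..}" "{0..t}"] x(2) by auto
    qed
    then show ?thesis using x0 x(1) by (auto simp: closure_Dset sgn_if split: if_splits)
  qed
  have "ode_solution g (closure (Dset \<beta> c)) x0 {0..} x"
    unfolding ode_solution_def
  proof (intro conjI ballI)
    fix t :: real assume "t \<in> {0..}"
    then show "x t \<in> closure (Dset \<beta> c)" "(x has_vector_derivative g (x t)) (at t within {0..})"
      using x(2)[rule_format, of t] P[of t] G(3)[rule_format, of "x t"] by (auto simp: closure_Dset)
  qed (rule x(1))
  then show thesis by (rule that)
qed

end

section \<open>Quadratic Lyapunov functions\<close>

lemma lyap_self [simp]: "lyap Y z z = 0"
  by (simp add: lyap_def)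

lemma continuous_on_lyap [continuous_intros]:
  "continuous_on S h \<Longrightarrow> continuous_on S (\<lambda>x. lyap Y z (h x))"
  unfolding lyap_def by (intro continuous_intros matrix_vector_mult_linear_continuous_on[THEN continuous_on_compose2]) auto

lemma lyap_pos: "pos_def Y \<Longrightarrow> x \<noteq> z \<Longrightarrow> lyap Y z x > 0"
  by (simp add: pos_def_def lyap_def)

lemma lyap_nonneg: "pos_def Y \<Longrightarrow> lyap Y z x \<ge> 0"
  using lyap_pos[of Y x z] by (cases "x = z") auto

text \<open>The constant is the minimum of the quadratic form on the unit sphere, positive by
  compactness.\<close>

lemma lyap_coercive:
  fixes Y :: "real^'n^'n"
  assumes "pos_def Y"
  obtains m where "m > 0" "\<forall>x z. m * (dist x z)\<^sup>2 \<le> lyap Y z x"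
proof -
  let ?S = "sphere 0 1 :: (real^'n) set"
  have "axis undefined 1 \<in> ?S" by simp
  then have "?S \<noteq> {}" by blast
  moreover have "continuous_on ?S (\<lambda>x. lyap Y 0 x)" by (intro continuous_intros)
  ultimately obtain v where v: "v \<in> ?S" "\<And>x. x \<in> ?S \<Longrightarrow> lyap Y 0 v \<le> lyap Y 0 x"
    using continuous_attains_inf[of ?S "\<lambda>x. lyap Y 0 x"] by auto
  show thesis
  proof (rule that)
    show "lyap Y 0 v > 0" using v(1) by (intro lyap_pos assms) auto
    have "lyap Y 0 v * (dist x z)\<^sup>2 \<le> lyap Y z x" for x z :: "real^'n"
    proof (cases "x = z")
      case False
      let ?r = "norm (x - z)"
      define u where "u = (1 / ?r) *\<^sub>R (x - z)"
      have r: "?r > 0" using False by simp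
      have eq: "?r *\<^sub>R u = x - z" using r by (simp add: u_def)
      have "lyap Y z x = (?r *\<^sub>R u) \<bullet> (Y *v (?r *\<^sub>R u))" unfolding eq lyap_def ..
      also have "\<dots> = ?r\<^sup>2 * lyap Y 0 u"
        by (simp add: lyap_def matrix_vector_mult_scaleR power2_eq_square)
      finally have "lyap Y z x = ?r\<^sup>2 * lyap Y 0 u" .
      moreover have "lyap Y 0 v \<le> lyap Y 0 u" using r by (intro v(2)) (simp add: u_def)
      ultimately show ?thesis by (simp add: dist_norm mult.commute mult_right_mono)
    qed simp
    then show "\<forall>x z. lyap Y 0 v * (dist x z)\<^sup>2 \<le> lyap Y z x" by blast
  qed
qed

lemma has_real_derivative_lyap:
  assumes "transpose Y = Y" and x: "(x has_vector_derivative v) (at t within I)"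
  shows "((\<lambda>t. lyap Y z (x t)) has_real_derivative 2 * ((x t - z) \<bullet> (Y *v v))) (at t within I)"
proof -
  have sym: "v \<bullet> (Y *v w) = w \<bullet> (Y *v v)" for v w
    using assms(1) by (metis dot_lmul_matrix inner_commute transpose_matrix_vector)
  have d: "((\<lambda>t. x t - z) has_vector_derivative v) (at t within I)"
    using x by (auto intro!: derivative_eq_intros)
  have "((\<lambda>t. Y *v (x t - z)) has_vector_derivative Y *v v) (at t within I)"
    by (rule bounded_linear.has_vector_derivative[OF matrix_vector_mul_bounded_linear d])
  from bounded_bilinear.has_vector_derivative[OF bounded_bilinear_inner d this]
  show ?thesis
    unfolding has_real_derivative_iff_has_vector_derivative lyap_def
    by (rule has_vector_derivative_eq_rhs) (simp add: sym[of v])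
qed

text \<open>The decay rate is known only inside the sublevel set, so the trajectory must first be
  confined there: at the first time with level at least \<open>\<epsilon>\<close>, Gronwall up to
  that time would already give a smaller level.\<close>

lemma lyap_exp_decay:
  fixes F :: "real^'n \<Rightarrow> real^'n"
  assumes Y: "transpose Y = Y" "pos_def Y" and \<gamma>: "\<gamma> > 0"
    and decay: "\<And>x. x \<in> sublevel S Y z \<epsilon> \<Longrightarrow> 2 * ((x - z) \<bullet> (Y *v F x)) \<le> - \<gamma> * lyap Y z x"
    and x: "\<And>t. t \<ge> a \<Longrightarrow> x t \<in> S \<and> (x has_vector_derivative F (x t)) (at t within {a..})"
    and start: "lyap Y z (x a) < \<epsilon>" and "a \<le> b"
  shows "lyap Y z (x b) \<le> lyap Y z (x a) * exp (- \<gamma> * (b - a))"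
proof -
  define V where "V t = lyap Y z (x t)" for t
  have dV: "(V has_real_derivative 2 * ((x t - z) \<bullet> (Y *v F (x t)))) (at t within {a..s})"
    if "t \<in> {a..s}" for s t
    unfolding V_def
  proof (rule has_real_derivative_lyap[OF Y(1)])
    have "(x has_vector_derivative F (x t)) (at t within {a..})" using x that by auto
    then show "(x has_vector_derivative F (x t)) (at t within {a..s})"
      by (rule has_vector_derivative_within_subset) auto
  qed
  have cont: "continuous_on {a..s} V" for s
    by (rule DERIV_continuous_on) (rule dV)
  have bound: "V s \<le> V a * exp (- \<gamma> * (s - a))" if "a \<le> s" "\<And>t. t \<in> {a..s} \<Longrightarrow> V t \<le> \<epsilon>" for s
  proof (rule exp_growth_bound[OF \<open>a \<le> s\<close> dV])
    fix t assume "t \<in> {a..s}"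
    then show "2 * ((x t - z) \<bullet> (Y *v F (x t))) \<le> - \<gamma> * V t"
      using decay[of "x t"] x[of t] that by (auto simp: sublevel_def V_def)
  qed
  have le: "V s < \<epsilon>" if "a \<le> s" for s
  proof (rule ccontr)
    define B where "B = {t \<in> {a..s}. \<epsilon> \<le> V t}"
    assume "\<not> V s < \<epsilon>"
    then have "B \<noteq> {}" using that by (auto simp: B_def)
    moreover have "B = {a..s} \<inter> V -` {\<epsilon>..}" by (auto simp: B_def)
    then have "compact B"
      using continuous_closed_preimage[OF cont[of s], of "{\<epsilon>..}"] bounded_subset[OF bounded_closed_interval[of a s]]
      unfolding compact_eq_bounded_closed by auto
    ultimately obtain r where r: "r \<in> B" "\<forall>t\<in>B. r \<le> t"
      using compact_attains_inf[of B] by blast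
    then have ar: "a \<le> r" "r \<le> s" "\<epsilon> \<le> V r" by (auto simp: B_def)
    have before: "V t < \<epsilon>" if "a \<le> t" "t < r" for t
    proof (rule ccontr)
      assume "\<not> V t < \<epsilon>"
      then have "t \<in> B" using that ar by (auto simp: B_def)
      then show False using r(2) that by auto
    qed
    \<comment> \<open>By the minimality of \<open>r\<close> this \<open>q\<close> must be
      \<open>r\<close>, so the level at \<open>r\<close> is exactly \<open>\<epsilon>\<close> and
      the bound applies up to and including \<open>r\<close>.\<close>
    obtain q where q: "a \<le> q" "q \<le> r" "V q = \<epsilon>"
      using IVT'[of V a \<epsilon> r] cont[of r] ar start unfolding V_def by auto
    have "V r = \<epsilon>" using before[of q] q by (cases "q = r") auto
    then have "V t \<le> \<epsilon>" if "t \<in> {a..r}" for t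
      using before[of t] that by (cases "t = r") auto
    then have "V r \<le> V a * exp (- \<gamma> * (r - a))"
      by (rule bound[OF ar(1)])
    also have "\<dots> \<le> V a * 1"
      using ar \<gamma> lyap_nonneg[OF Y(2)] by (intro mult_left_mono) (auto simp: V_def)
    also have "\<dots> < \<epsilon>" using start by (simp add: V_def)
    finally show False using \<open>V r = \<epsilon>\<close> by simp
  qed
  show ?thesis
    unfolding V_def[symmetric]
  proof (rule bound[OF \<open>a \<le> b\<close>])
    fix t assume "t \<in> {a..b}"
    then show "V t \<le> \<epsilon>" using le[of t] by simp
  qed
qed

lemma lyap_exp_decay_tendsto:
  fixes Y :: "real^'n^'n"
  assumes Y: "pos_def Y" and \<gamma>: "\<gamma> > 0"
    and V: "\<And>t. t \<ge> a \<Longrightarrow> lyap Y z (x t) \<le> M * exp (- \<gamma> * (t - a))"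
  shows "(x \<longlongrightarrow> z) at_top"
proof -
  obtain m where m: "m > 0" "\<forall>x z. m * (dist x z)\<^sup>2 \<le> lyap Y z x" by (rule lyap_coercive[OF Y])
  have "((\<lambda>t. (dist (x t) z)\<^sup>2) \<longlongrightarrow> 0) at_top"
  proof (rule tendsto_sandwich[OF _ _ tendsto_const])
    show "\<forall>\<^sub>F t in at_top. 0 \<le> (dist (x t) z)\<^sup>2" by simp
    show "\<forall>\<^sub>F t in at_top. (dist (x t) z)\<^sup>2 \<le> M / m * exp (- \<gamma> * (t - a))"
      using eventually_ge_at_top[of a]
    proof eventually_elim
      case (elim t)
      show ?case using order_trans[OF m(2)[rule_format] V[OF elim]] m(1) by (simp add: field_simps)
    qed
    have "filterlim (\<lambda>t. - \<gamma> * (t - a)) at_bot at_top"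
      using \<gamma> by real_asymp
    then have "((\<lambda>t. exp (- \<gamma> * (t - a))) \<longlongrightarrow> 0) at_top"
      by (rule filterlim_compose[OF exp_at_bot])
    then show "((\<lambda>t. M / m * exp (- \<gamma> * (t - a))) \<longlongrightarrow> 0) at_top"
      by (rule tendsto_mult_right_zero)
  qed
  then have "((\<lambda>t. dist (x t) z) \<longlongrightarrow> 0) at_top"
    using tendsto_real_sqrt[of "\<lambda>t. (dist (x t) z)\<^sup>2" 0 at_top] by simp
  then show ?thesis by (rule tendsto_dist_iff[THEN iffD2])
qed

text \<open>Lyapunov's direct method relative to \<open>S\<close>. Existence of solutions inside
  \<open>S\<close> is a hypothesis because \<open>z\<close> may lie on the boundary of
  \<open>S\<close>.\<close>

lemma lyap_asymptotically_stable:
  fixes F :: "real^'n \<Rightarrow> real^'n"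
  assumes Y: "transpose Y = Y" "pos_def Y" and \<gamma>: "\<gamma> > 0" and \<epsilon>: "\<epsilon> > 0"
    and decay: "\<And>x. x \<in> sublevel S Y z \<epsilon> \<Longrightarrow> 2 * ((x - z) \<bullet> (Y *v F x)) \<le> - \<gamma> * lyap Y z x"
    and z: "z \<in> S" "F z = 0"
    and ex: "\<And>x0. x0 \<in> S \<Longrightarrow> \<exists>x. ode_solution F S x0 {0..} x"
  shows "asymptotically_stable F S z"
proof -
  obtain m where m: "m > 0" "\<forall>x z. m * (dist x z)\<^sup>2 \<le> lyap Y z x" by (rule lyap_coercive[OF Y(2)])
  have small: "\<exists>d>0. \<forall>x. dist x z < d \<longrightarrow> lyap Y z x < \<eta>" if "\<eta> > 0" for \<eta>
  proof -
    have "continuous_on UNIV (\<lambda>x. lyap Y z x)" by (intro continuous_intros)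
    then have "\<exists>d>0. \<forall>x. dist x z < d \<longrightarrow> dist (lyap Y z x) (lyap Y z z) < \<eta>"
      using that unfolding continuous_on_iff by blast
    then obtain d where "d > 0" "\<And>x. dist x z < d \<Longrightarrow> \<bar>lyap Y z x\<bar> < \<eta>"
      by (auto simp: dist_real_def)
    then show ?thesis by (intro exI[of _ d]) force
  qed
  have V: "lyap Y z (x t) \<le> lyap Y z x0 * exp (- \<gamma> * t)"
    if "ode_solution F S x0 {0..} x" "lyap Y z x0 < \<epsilon>" "t \<ge> 0" for x x0 t
    using lyap_exp_decay[OF Y \<gamma> decay, where a = 0 and b = t and x = x] that
    by (auto simp: ode_solution_def)
  show ?thesis
    unfolding asymptotically_stable_def
  proof (intro conjI allI impI)
    fix e :: real assume "e > 0"
    \<comment> \<open>The level \<open>\<epsilon>\<close> secures the decay estimate; the level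
      \<open>m * e\<^sup>2\<close> becomes the distance \<open>e\<close> by coercivity.\<close>
    then have "min \<epsilon> (m * e\<^sup>2) > 0" using \<epsilon> m(1) by simp
    from small[OF this] obtain d where d: "d > 0" "\<And>x. dist x z < d \<Longrightarrow> lyap Y z x < min \<epsilon> (m * e\<^sup>2)" by blast
    have "dist (x t) z < e" if x: "x0 \<in> S" "dist x0 z < d" "ode_solution F S x0 {0..} x" "t \<ge> 0" for x0 x t
    proof -
      have "lyap Y z x0 < min \<epsilon> (m * e\<^sup>2)" using d x by blast
      then have "lyap Y z x0 < \<epsilon>" "lyap Y z x0 < m * e\<^sup>2" by auto
      have "m * (dist (x t) z)\<^sup>2 \<le> lyap Y z (x t)" by (simp add: m(2))
      also have "\<dots> \<le> lyap Y z x0 * exp (- \<gamma> * t)"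
        by (rule V[OF x(3) \<open>lyap Y z x0 < \<epsilon>\<close> x(4)])
      also have "\<dots> \<le> lyap Y z x0 * 1"
        using \<gamma> x(4) lyap_nonneg[OF Y(2)] by (intro mult_left_mono) auto
      also have "\<dots> < m * e\<^sup>2" using \<open>lyap Y z x0 < m * e\<^sup>2\<close> by simp
      finally have "(dist (x t) z)\<^sup>2 < e\<^sup>2" using m(1) by simp
      then show ?thesis using \<open>e > 0\<close> by (meson less_imp_le power_less_imp_less_base)
    qed
    then show "\<exists>d>0. \<forall>x0\<in>S. dist x0 z < d \<longrightarrow> (\<exists>x. ode_solution F S x0 {0..} x) \<and>
        (\<forall>x. ode_solution F S x0 {0..} x \<longrightarrow> (\<forall>t\<ge>0. dist (x t) z < e))"
      using d(1) ex by blast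
  next
    obtain d where d: "d > 0" "\<And>x. dist x z < d \<Longrightarrow> lyap Y z x < \<epsilon>" using small[OF \<epsilon>] by blast
    have "(x \<longlongrightarrow> z) at_top" if x: "dist x0 z < d" "ode_solution F S x0 {0..} x" for x0 x
      using V[OF x(2) d(2)[OF x(1)]]
      by (intro lyap_exp_decay_tendsto[OF Y(2) \<gamma>, where a = 0 and M = "lyap Y z x0"]) simp
    then show "\<exists>d>0. \<forall>x0\<in>S. dist x0 z < d \<longrightarrow> (\<forall>x. ode_solution F S x0 {0..} x \<longrightarrow> (x \<longlongrightarrow> z) at_top)"
      using d(1) by blast
  qed (use z in auto)
qed

text \<open>Substitution of \<open>l = V t\<close>, using \<open>dt \<le> - dl / (\<gamma> l)\<close>.\<close>

lemma integral_along_decaying_function: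
  fixes V V' h \<phi> :: "real \<Rightarrow> real"
  assumes "a \<le> b" and "\<gamma> > 0"
    and dV: "\<And>t. t \<in> {a..b} \<Longrightarrow> (V has_real_derivative V' t) (at t within {a..b})"
    and pos: "\<And>t. t \<in> {a..b} \<Longrightarrow> 0 < V t"
    and dec: "\<And>t. t \<in> {a..b} \<Longrightarrow> V' t \<le> - \<gamma> * V t"
    and "V a \<le> \<epsilon>"
    and \<phi>: "\<And>l. l \<ge> 0 \<Longrightarrow> \<phi> l \<ge> 0" "(\<lambda>l. \<phi> l / l) absolutely_integrable_on {0..\<epsilon>}"
    and h: "h integrable_on {a..b}" "\<And>t. t \<in> {a..b} \<Longrightarrow> h t \<le> \<phi> (V t)"
  shows "integral {a..b} h \<le> 1 / \<gamma> * integral {0..\<epsilon>} (\<lambda>l. \<phi> l / l)"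
proof -
  let ?\<psi> = "\<lambda>l. \<phi> l / l"
  have V': "V' t < 0" if "t \<in> {a..b}" for t
    using dec[OF that] pos[OF that] \<open>\<gamma> > 0\<close> by (smt (verit) mult_minus_left mult_pos_pos)
  have cont: "continuous_on {a..b} V" by (rule DERIV_continuous_on) (rule dV)
  have anti: "V t < V s" if "s \<in> {a..b}" "t \<in> {a..b}" "s < t" for s t
  proof (rule DERIV_neg_imp_decreasing_open[OF \<open>s < t\<close>])
    fix r assume "s < r" "r < t"
    then show "\<exists>y. (V has_real_derivative y) (at r) \<and> y < 0"
      using that dV[of r] V'[of r] at_within_Icc_at[of a r b] by auto
  next
    show "continuous_on {s..t} V" using cont that by (auto intro: continuous_on_subset)
  qed
  \<comment> \<open>Injectivity and absolute integrability on the image are what the change of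
    variables asks for.\<close>
  then have inj: "inj_on V {a..b}"
    by (intro inj_onI) (metis less_irrefl linorder_neqE_linordered_idom)
  have sub: "V ` {a..b} \<subseteq> {0..\<epsilon>}"
  proof
    fix v assume "v \<in> V ` {a..b}"
    then obtain t where t: "t \<in> {a..b}" "v = V t" by auto
    then have "V t \<le> V a" using anti[of a t] by (cases "t = a") auto
    then show "v \<in> {0..\<epsilon>}" using t pos[of t] \<open>V a \<le> \<epsilon>\<close> by auto
  qed
  have "compact (V ` {a..b})" using cont by (intro compact_continuous_image) auto
  then have "V ` {a..b} \<in> sets lebesgue" by (simp add: compact_imp_closed borel_closed)
  then have ai: "?\<psi> absolutely_integrable_on V ` {a..b}"
    by (rule set_integrable_subset[OF \<phi>(2) _ sub])
  have cv: "(\<lambda>t. \<bar>V' t\<bar> * ?\<psi> (V t)) absolutely_integrable_on {a..b}"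
     "integral {a..b} (\<lambda>t. \<bar>V' t\<bar> * ?\<psi> (V t)) = integral (V ` {a..b}) ?\<psi>"
    using has_absolute_integral_change_of_variables_1'[of "{a..b}" V V' ?\<psi> "integral (V ` {a..b}) ?\<psi>"] dV inj ai
    by auto
  have "integral {a..b} h \<le> integral {a..b} (\<lambda>t. 1 / \<gamma> * (\<bar>V' t\<bar> * ?\<psi> (V t)))"
  proof (rule integral_le[OF h(1)])
    show "(\<lambda>t. 1 / \<gamma> * (\<bar>V' t\<bar> * ?\<psi> (V t))) integrable_on {a..b}"
      using integrable_cmul[OF set_lebesgue_integral_eq_integral(1)[OF cv(1)], of "1 / \<gamma>"]
      by (simp only: real_scaleR_def)
    fix t assume t: "t \<in> {a..b}"
    have "\<phi> (V t) * (\<gamma> * V t) \<le> \<phi> (V t) * \<bar>V' t\<bar>"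
      using dec[OF t] \<phi>(1)[of "V t"] pos[OF t] by (intro mult_left_mono) auto
    then have "\<phi> (V t) \<le> 1 / \<gamma> * (\<bar>V' t\<bar> * ?\<psi> (V t))"
      using pos[OF t] \<open>\<gamma> > 0\<close> by (simp add: field_simps)
    then show "h t \<le> 1 / \<gamma> * (\<bar>V' t\<bar> * ?\<psi> (V t))" using h(2)[OF t] by simp
  qed
  also have "\<dots> = 1 / \<gamma> * integral (V ` {a..b}) ?\<psi>" by (simp only: integral_mult_right cv(2))
  \<comment> \<open>The integrand is nonnegative on \<open>[0, \<epsilon>]\<close>, with value 0 at
    0 by the convention for division, so enlarging the image to the whole interval only increases
    the integral.\<close>
  also have "\<dots> \<le> 1 / \<gamma> * integral {0..\<epsilon>} ?\<psi>"
    using \<open>\<gamma> > 0\<close> sub \<phi> set_lebesgue_integral_eq_integral(1)[OF ai] set_lebesgue_integral_eq_integral(1)[OF \<phi>(2)]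
    by (intro mult_left_mono integral_subset_le) auto
  finally show ?thesis .
qed

theorem theorem4p4:
  fixes \<alpha> \<beta> :: "'n::finite \<Rightarrow> nat" and c k :: nat
    and f g :: "real^'n \<Rightarrow> real^'n" and Dbar :: "(real^'n) set"
    and y0 x0 xs :: "real^'n" and Nt :: "(real^'n) set" and Y :: "real^'n^'n"
    and \<epsilon> \<tau>N c1 cN :: real and X :: "real \<Rightarrow> real^'n" and C :: "real \<Rightarrow> real"
  assumes alpha_pos: "\<And>i. \<alpha> i \<ge> 1" and beta_pos: "\<And>i. \<beta> i \<ge> 1"
    and c_pos: "c \<ge> 1" and k_pos: "k \<ge> 1"
    and alpha_beta: "\<And>i. \<alpha> i * \<beta> i = c"
    and Dbar_def: "Dbar = closure (Dset \<beta> c)"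
    and g_def: "g = desing_field \<alpha> \<beta> c k f"
    and x0_def: "x0 = T_para \<alpha> \<beta> c y0"
    and f_C1: "C1_on UNIV f"
    and f_asymp: "asymp_quasi_homogeneous \<alpha> k f"
    and g_C1: "C1_on Dbar g"
    and xs_E: "xs \<in> Eset \<beta> c" and g_xs: "g xs = 0"
    and Nt_compact: "compact Nt" and Nt_sub: "Nt \<subseteq> Dbar" and xs_Nt: "xs \<in> Nt"
    and Nt_star: "\<And>x. x \<in> Nt \<Longrightarrow> closed_segment xs x \<subseteq> Nt"
    and Y_sym: "transpose Y = Y" and Y_pos: "pos_def Y"
    and A_neg: "\<And>x. x \<in> Nt \<Longrightarrow>
      neg_def (transpose (jacobian g (at x within Dbar)) ** Y + Y ** jacobian g (at x within Dbar))"
    and eps_pos: "\<epsilon> > 0" and N_sub: "sublevel Dbar Y xs \<epsilon> \<subseteq> Nt"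
    and eps_max: "\<And>\<epsilon>'. \<epsilon>' > 0 \<Longrightarrow> sublevel Dbar Y xs \<epsilon>' \<subseteq> Nt \<Longrightarrow> \<epsilon>' \<le> \<epsilon>"
    and tauN_pos: "\<tau>N > 0" and X_sol: "ode_solution g Dbar x0 {0..\<tau>N} X"
    and X_end: "X \<tau>N \<in> {x \<in> Dbar. lyap Y xs x < \<epsilon>}"
    and c1_pos: "c1 > 0" and cN_pos: "cN > 0"
    and decay: "\<And>x. x \<in> Nt \<Longrightarrow> 2 * ((x - xs) \<bullet> (Y *v g x)) \<le> - c1 * cN * lyap Y xs x"
    and C_meas: "C \<in> borel_measurable (lebesgue_on {0..})" and C_nonneg: "\<And>l. l \<ge> 0 \<Longrightarrow> C l \<ge> 0"
    and C_bound: "\<And>x. x \<in> Nt \<Longrightarrow> \<bar>1 - pfun \<beta> c x ^ (2 * c)\<bar> \<le> C (lyap Y xs x)"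
    and C_int: "(\<lambda>l. C l ^ k / l) absolutely_integrable_on {0..\<epsilon>}"
  shows "asymptotically_stable g Dbar xs \<and>
    (\<exists>x. ode_solution g Dbar x0 {0..} x \<and> (\<forall>\<tau>\<in>{0..\<tau>N}. x \<tau> = X \<tau>) \<and>
      (x \<longlongrightarrow> xs) at_top \<and>
      (\<exists>y tmax. blow_up_solution f y0 y tmax \<and>
         orig_time \<beta> c k x ` {0..} = {0..<tmax} \<and>
         (\<forall>\<tau>\<ge>0. y (orig_time \<beta> c k x \<tau>) = T_para_inv \<alpha> \<beta> c (x \<tau>)) \<and>
         tmax \<in> {orig_time \<beta> c k X \<tau>N ..
           orig_time \<beta> c k X \<tau>N + 1 / (cN * c1) * integral {0..\<epsilon>} (\<lambda>l. C l ^ k / l)}))"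
proof -
  interpret quasi_parabolic \<alpha> \<beta> c
    using alpha_pos beta_pos c_pos alpha_beta by unfold_locales auto
  let ?D = "closure (Dset \<beta> c)"
  define \<gamma> where "\<gamma> = c1 * cN"
  have \<gamma>: "\<gamma> > 0" using c1_pos cN_pos by (simp add: \<gamma>_def)
  have gC1: "C1_on ?D g" using g_C1 Dbar_def by simp
  \<comment> \<open>The factor \<open>1 - P z\<close> in \<open>gradP_desing_field\<close> vanishes
    on the boundary.\<close>
  have tang: "gradP z \<bullet> g z = 0" if "P z = 1" for z
    using that gradP_desing_field[of z k f] by (simp add: g_def)
  have dec: "2 * ((x - xs) \<bullet> (Y *v g x)) \<le> - \<gamma> * lyap Y xs x" if "x \<in> sublevel Dbar Y xs \<epsilon>" for x
    using decay[of x] N_sub that unfolding \<gamma>_def by auto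
  have xsP: "P xs = 1" using xs_E by (simp add: Eset_eq)
  have ex: "\<exists>x. ode_solution g Dbar z {0..} x" if "z \<in> Dbar" for z
    using ode_solution_tangent_exists[OF gC1 tang, of z] that unfolding Dbar_def by blast
  have stable: "asymptotically_stable g Dbar xs"
    using Nt_sub xs_Nt by (intro lyap_asymptotically_stable[OF Y_sym Y_pos \<gamma> eps_pos dec _ g_xs ex]) auto

  \<comment> \<open>The global trajectory and its agreement with \<open>X\<close>\<close>
  have x0D: "P x0 < 1" using T_para_in_Dset[of y0] by (simp add: x0_def Dset_eq)
  then have "x0 \<in> Dbar" by (simp add: Dbar_def closure_Dset)
  then obtain x where sol: "ode_solution g Dbar x0 {0..} x" using ex by blast
  then have x_0: "x 0 = x0" and x_in: "\<And>t. t \<ge> 0 \<Longrightarrow> x t \<in> Dbar"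
    and x_der: "\<And>t. t \<ge> 0 \<Longrightarrow> (x has_vector_derivative g (x t)) (at t within {0..})"
    by (auto simp: ode_solution_def)
  have x_der': "(x has_vector_derivative g (x t)) (at t within I)" if "t \<ge> 0" "I \<subseteq> {0..}" for t I
    using x_der[OF that(1)] that(2) by (rule has_vector_derivative_within_subset)
  have x_D: "P (x t) < 1" if "t \<ge> 0" for t
    using ode_solution_tangent_stays_in_Dset[OF gC1 tang _ x0D that] sol by (simp add: Dbar_def)
  have x_cont: "continuous_on {0..} x"
    using x_der by (intro continuous_on_vector_derivative) auto
  obtain L where L: "L-lipschitz_on Dbar g"
    unfolding Dbar_def by (rule C1_on_lipschitz[OF gC1 compact_closure_Dset convex_closure[OF convex_Dset]])
  have xX: "x \<tau> = X \<tau>" if \<tau>: "\<tau> \<in> {0..\<tau>N}" for \<tau>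
  proof (rule ode_unique[OF L])
    fix t assume t: "t \<in> {0..\<tau>}"
    then show "x t \<in> Dbar \<and> (x has_vector_derivative g (x t)) (at t within {0..\<tau>})"
      using x_in x_der' by auto
    have "X t \<in> Dbar" "(X has_vector_derivative g (X t)) (at t within {0..\<tau>N})"
      using X_sol t \<tau> by (auto simp: ode_solution_def)
    moreover have "{0..\<tau>} \<subseteq> {0..\<tau>N}" using \<tau> by auto
    ultimately show "X t \<in> Dbar \<and> (X has_vector_derivative g (X t)) (at t within {0..\<tau>})"
      using has_vector_derivative_within_subset by blast
  qed (use \<tau> x_0 X_sol in \<open>auto simp: ode_solution_def\<close>)

  \<comment> \<open>Decay of the Lyapunov function after \<open>\<tau>N\<close>\<close>
  define V where "V t = lyap Y xs (x t)" for t
  have V_start: "V \<tau>N < \<epsilon>" using X_end xX[of \<tau>N] tauN_pos by (simp add: V_def)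
  have V_decay: "V t \<le> V \<tau>N * exp (- \<gamma> * (t - \<tau>N))" if "t \<ge> \<tau>N" for t
    unfolding V_def
  proof (rule lyap_exp_decay[OF Y_sym Y_pos \<gamma> dec])
    fix s assume "\<tau>N \<le> s"
    then show "x s \<in> Dbar \<and> (x has_vector_derivative g (x s)) (at s within {\<tau>N..})"
      using x_in x_der' tauN_pos by auto
  qed (use V_start that in \<open>auto simp: V_def\<close>)
  have lim: "(x \<longlongrightarrow> xs) at_top"
    using V_decay unfolding V_def by (rule lyap_exp_decay_tendsto[OF Y_pos \<gamma>])
  \<comment> \<open>The trajectory stays strictly inside while \<open>xs\<close> is on the boundary,
    so \<open>xs\<close> is never reached in finite time. The substitution \<open>l = V t\<close>
    relies on this positivity.\<close>
  have V_pos: "V t > 0" if "t \<ge> 0" for t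
  proof -
    have "x t \<noteq> xs" using x_D[OF that] xsP by auto
    then show ?thesis unfolding V_def by (rule lyap_pos[OF Y_pos])
  qed
  have x_N: "x t \<in> sublevel Dbar Y xs \<epsilon>" if "t \<ge> \<tau>N" for t
  proof -
    have "V t \<le> V \<tau>N * exp (- \<gamma> * (t - \<tau>N))" by (rule V_decay[OF that])
    also have "\<dots> \<le> V \<tau>N * 1"
      using V_pos[of \<tau>N] tauN_pos \<gamma> that by (intro mult_left_mono) auto
    finally show ?thesis
      using V_start x_in[of t] that tauN_pos by (auto simp: sublevel_def V_def)
  qed

  \<comment> \<open>The original time along the trajectory\<close>
  define \<rho> where "\<rho> t = time_factor \<beta> c (x t) * (1 - P (x t)) ^ k" for t
  define \<theta> where "\<theta> = orig_time \<beta> c k x"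
  have \<theta>_eq: "\<theta> \<tau> = integral {0..\<tau>} \<rho>" for \<tau>
    by (simp add: \<theta>_def orig_time_def \<rho>_def[abs_def] pfun_power)
  have \<rho>_pos: "\<rho> t > 0" if "t \<ge> 0" for t
    using x_D[OF that] time_factor_pos by (simp add: \<rho>_def)
  have \<rho>_cont: "continuous_on {0..} \<rho>"
    unfolding \<rho>_def by (intro continuous_intros x_cont)
  have \<rho>_int: "\<rho> integrable_on {a..b}" if "a \<ge> 0" for a b
    using that by (intro integrable_continuous_real continuous_on_subset[OF \<rho>_cont]) auto
  have \<theta>_der: "(\<theta> has_real_derivative \<rho> t) (at t within {0..})" if "t \<ge> 0" for t
    unfolding \<theta>_eq[abs_def] has_real_derivative_iff_has_vector_derivative
    by (rule integral_has_vector_derivative_atLeast[OF \<rho>_cont that])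
  have \<theta>_cont: "continuous_on {0..} \<theta>"
    by (rule DERIV_continuous_on) (use \<theta>_der in auto)
  have \<theta>_0: "\<theta> 0 = 0" by (simp add: \<theta>_eq)
  have \<theta>_split: "\<theta> b = \<theta> a + integral {a..b} \<rho>" if "0 \<le> a" "a \<le> b" for a b
    unfolding \<theta>_eq using Henstock_Kurzweil_Integration.integral_combine[OF that \<rho>_int] by simp
  have \<theta>_mono: "\<theta> a < \<theta> b" if "0 \<le> a" "a < b" for a b
  proof (rule DERIV_pos_imp_increasing_open[OF that(2)])
    fix t assume "a < t" "t < b"
    then have "t > 0" using that by simp
    then have "at t within {0..} = at t" by (intro at_within_interior) simp
    then show "\<exists>y. (\<theta> has_real_derivative y) (at t) \<and> 0 < y"
      using \<theta>_der[of t] \<rho>_pos[of t] \<open>t > 0\<close> by auto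
  next
    show "continuous_on {a..b} \<theta>" using that by (intro continuous_on_subset[OF \<theta>_cont]) auto
  qed

  \<comment> \<open>Bound for the original time elapsing after \<open>\<tau>N\<close>\<close>
  define B where "B = 1 / \<gamma> * integral {0..\<epsilon>} (\<lambda>l. C l ^ k / l)"
  have tail: "integral {\<tau>N..b} \<rho> \<le> B" if "\<tau>N \<le> b" for b
    unfolding B_def
  proof (rule integral_along_decaying_function[OF that \<gamma>, where V = V
        and V' = "\<lambda>t. 2 * ((x t - xs) \<bullet> (Y *v g (x t)))"])
    fix t assume t: "t \<in> {\<tau>N..b}"
    then have "t \<ge> 0" using tauN_pos by simp
    show "(V has_real_derivative 2 * ((x t - xs) \<bullet> (Y *v g (x t)))) (at t within {\<tau>N..b})"
      unfolding V_def using tauN_pos \<open>t \<ge> 0\<close>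
      by (intro has_real_derivative_lyap Y_sym x_der') auto
    show "0 < V t" by (rule V_pos[OF \<open>t \<ge> 0\<close>])
    show "2 * ((x t - xs) \<bullet> (Y *v g (x t))) \<le> - \<gamma> * V t"
      unfolding V_def using t by (intro dec x_N) simp
    have "1 - P (x t) \<le> C (V t)"
      using C_bound[of "x t"] x_N[of t] N_sub t by (auto simp: V_def pfun_power)
    then have "(1 - P (x t)) ^ k \<le> C (V t) ^ k"
      using x_D[OF \<open>t \<ge> 0\<close>] by (intro power_mono) auto
    moreover have "\<rho> t \<le> 1 * (1 - P (x t)) ^ k"
      unfolding \<rho>_def using x_D[OF \<open>t \<ge> 0\<close>] by (intro mult_right_mono time_factor_le_1) auto
    ultimately show "\<rho> t \<le> C (V t) ^ k" by simp
  qed (use V_start C_nonneg C_int \<rho>_int tauN_pos in auto)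
  have B_nonneg: "B \<ge> 0" using tail[of \<tau>N] by simp
  have \<theta>_bound: "\<theta> t \<le> \<theta> \<tau>N + B" if "t \<ge> 0" for t
  proof (cases "t \<le> \<tau>N")
    case True
    then show ?thesis using \<theta>_mono[OF that, of \<tau>N] B_nonneg by (cases "t = \<tau>N") auto
  next
    case False
    then show ?thesis using \<theta>_split[of \<tau>N t] tail[of t] tauN_pos by auto
  qed

  \<comment> \<open>The blow-up time as the supremum of the original time\<close>
  define tmax where "tmax = (SUP t\<in>{0..}. \<theta> t)"
  have bdd: "bdd_above (\<theta> ` {0..})" using \<theta>_bound by (auto intro!: bdd_aboveI)
  \<comment> \<open>Strict monotonicity keeps the supremum from being attained, which makes the
    image of \<open>\<theta>\<close> half-open.\<close>
  have \<theta>_less: "\<theta> t < tmax" if "t \<ge> 0" for t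
  proof -
    have "\<theta> t < \<theta> (t + 1)" using that by (intro \<theta>_mono) auto
    also have "\<dots> \<le> tmax" unfolding tmax_def using that by (intro cSUP_upper bdd) auto
    finally show ?thesis .
  qed
  have tmax_le: "tmax \<le> \<theta> \<tau>N + B"
    unfolding tmax_def using \<theta>_bound by (intro cSUP_least) auto
  have img: "\<theta> ` {0..} = {0..<tmax}"
  proof
    show "\<theta> ` {0..} \<subseteq> {0..<tmax}"
    proof
      fix s assume "s \<in> \<theta> ` {0..}"
      then obtain t where t: "t \<ge> 0" "s = \<theta> t" by auto
      then show "s \<in> {0..<tmax}"
        using \<theta>_mono[of 0 t] \<theta>_0 \<theta>_less[of t] by (cases "t = 0") auto
    qed
    show "{0..<tmax} \<subseteq> \<theta> ` {0..}"
    proof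
      fix s assume s: "s \<in> {0..<tmax}"
      then obtain t where t: "t \<ge> 0" "s < \<theta> t"
        unfolding tmax_def using less_cSUP_iff[OF _ bdd, of s] by auto
      moreover have "continuous_on {0..t} \<theta>" by (intro continuous_on_subset[OF \<theta>_cont]) auto
      ultimately obtain r where "0 \<le> r" "\<theta> r = s"
        using IVT'[of \<theta> 0 s t] s \<theta>_0 by auto
      then show "s \<in> \<theta> ` {0..}" by auto
    qed
  qed

  \<comment> \<open>The solution in original time and its blow-up\<close>
  define w where "w t = T_para_inv \<alpha> \<beta> c (x t)" for t
  have w_der: "(w has_vector_derivative \<rho> t *\<^sub>R f (w t)) (at t within {0..})" if "t \<ge> 0" for t
    unfolding w_def \<rho>_def using x_der[OF that] x_D[OF that] unfolding g_def
    by (rule has_vector_derivative_T_para_inv)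
  obtain y where y: "\<forall>t\<ge>0. y (\<theta> t) = w t"
    "\<forall>t\<in>\<theta> ` {0..}. (y has_vector_derivative f (y t)) (at t within \<theta> ` {0..})"
    by (rule ode_time_change[OF \<theta>_der \<rho>_pos \<theta>_0 w_der])
  have "w 0 = y0" by (simp add: w_def x_0 x0_def T_para_inv_T_para)
  then have y_sol: "ode_solution f UNIV y0 {0..<tmax} y"
    using y \<theta>_0 unfolding ode_solution_def img by auto
  \<comment> \<open>If \<open>w\<close> were bounded, then each coordinate of \<open>x\<close>,
    being that of \<open>w\<close> times \<open>(1 - P (x t)) ^ \<alpha> j\<close>, would tend to 0,
    although \<open>P xs = 1\<close> excludes \<open>xs = 0\<close>.\<close>
  have unbounded: "\<not> (\<exists>M. \<forall>t\<ge>0. norm (w t) \<le> M)"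
  proof
    assume "\<exists>M. \<forall>t\<ge>0. norm (w t) \<le> M"
    then obtain M where M: "\<And>t. t \<ge> 0 \<Longrightarrow> norm (w t) \<le> M" by blast
    have "xs $ j = 0" for j
    proof (rule tendsto_unique[OF trivial_limit_at_top_linorder])
      show "((\<lambda>t. x t $ j) \<longlongrightarrow> xs $ j) at_top" by (rule tendsto_vec_nth[OF lim])
      have "continuous_on UNIV P" by (intro continuous_intros)
      then have "isCont P xs" by (simp add: continuous_on_eq_continuous_at)
      then have "((\<lambda>t. P (x t)) \<longlongrightarrow> P xs) at_top" using lim by (rule isCont_tendsto_compose)
      then have "((\<lambda>t. (1 - P (x t)) ^ \<alpha> j * M) \<longlongrightarrow> (1 - P xs) ^ \<alpha> j * M) at_top"
        by (intro tendsto_intros)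
      moreover have "(1 - P xs) ^ \<alpha> j = 0" using xsP alpha_pos[of j] by simp
      ultimately have M0: "((\<lambda>t. (1 - P (x t)) ^ \<alpha> j * M) \<longlongrightarrow> 0) at_top" by simp
      show "((\<lambda>t. x t $ j) \<longlongrightarrow> 0) at_top"
      proof (rule Lim_null_comparison[OF _ M0])
        show "\<forall>\<^sub>F t in at_top. norm (x t $ j) \<le> (1 - P (x t)) ^ \<alpha> j * M"
          using eventually_ge_at_top[of 0]
        proof eventually_elim
          case (elim t)
          have u: "(1 - P (x t)) ^ \<alpha> j > 0" using x_D[OF elim] by simp
          then have "x t $ j = (1 - P (x t)) ^ \<alpha> j * w t $ j"
            using x_D[OF elim] by (simp add: w_def T_para_inv_nth)
          then have "norm (x t $ j) = (1 - P (x t)) ^ \<alpha> j * \<bar>w t $ j\<bar>"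
            using u by (simp add: abs_mult)
          also have "\<dots> \<le> (1 - P (x t)) ^ \<alpha> j * M"
            using u M[OF elim] component_le_norm_cart[of "w t" j] by (intro mult_left_mono) auto
          finally show ?case .
        qed
      qed
    qed
    then have "xs = 0" by (simp add: vec_eq_iff)
    then show False using xsP by simp
  qed
  have "blow_up_solution f y0 y tmax"
    unfolding blow_up_solution_def
  proof (intro conjI notI)
    show "tmax > 0" using \<theta>_less[of 0] \<theta>_0 by simp
    show "ode_solution f UNIV y0 {0..<tmax} y" by (rule y_sol)
    \<comment> \<open>A continuation past \<open>tmax\<close> would be continuous, hence bounded, on
      the compact interval \<open>[0, tmax]\<close>, and there it takes all values of
      \<open>w\<close>.\<close>
    assume "\<exists>T'>tmax. \<exists>z. ode_solution f UNIV y0 {0..<T'} z \<and> (\<forall>t\<in>{0..<tmax}. z t = y t)"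
    then obtain T' z where T': "T' > tmax" and z: "ode_solution f UNIV y0 {0..<T'} z"
      and zy: "\<forall>t\<in>{0..<tmax}. z t = y t" by blast
    have "continuous_on {0..<T'} z"
      using z by (intro continuous_on_vector_derivative) (auto simp: ode_solution_def)
    then have "continuous_on {0..tmax} z" by (rule continuous_on_subset) (use T' in auto)
    then have "bounded (z ` {0..tmax})"
      by (intro compact_imp_bounded compact_continuous_image) auto
    then obtain M where M: "\<forall>v\<in>z ` {0..tmax}. norm v \<le> M" unfolding bounded_iff by blast
    have "norm (w t) \<le> M" if "t \<ge> 0" for t
    proof -
      have "\<theta> t \<in> {0..<tmax}" using img that by auto
      then have "z (\<theta> t) = w t" "\<theta> t \<in> {0..tmax}" using zy y(1) that by auto
      then show ?thesis using M by (metis imageI)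
    qed
    then show False using unbounded by blast
  qed
  moreover have "\<theta> \<tau>N = orig_time \<beta> c k X \<tau>N"
    unfolding \<theta>_def orig_time_def by (rule integral_cong) (simp add: xX)
  moreover have "B = 1 / (cN * c1) * integral {0..\<epsilon>} (\<lambda>l. C l ^ k / l)"
    by (simp add: B_def \<gamma>_def mult.commute)
  moreover have "\<theta> \<tau>N \<le> tmax" using \<theta>_less[of \<tau>N] tauN_pos by simp
  ultimately have "blow_up_solution f y0 y tmax \<and> orig_time \<beta> c k x ` {0..} = {0..<tmax} \<and>
      (\<forall>\<tau>\<ge>0. y (orig_time \<beta> c k x \<tau>) = T_para_inv \<alpha> \<beta> c (x \<tau>)) \<and>
      tmax \<in> {orig_time \<beta> c k X \<tau>N ..
        orig_time \<beta> c k X \<tau>N + 1 / (cN * c1) * integral {0..\<epsilon>} (\<lambda>l. C l ^ k / l)}"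
    using img y(1) tmax_le unfolding \<theta>_def w_def by auto
  then show ?thesis using stable sol xX lim by blast
qed

end
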